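(* Let $n\ge1$, $s\in(0,1)$, let $\Omega\subset\mathbb{R}^n$ be a bounded open set with Lipschitz boundary, $\varphi:\mathbb{R}^n\to\mathbb{R}$, $A\subset\Omega$ an open set and $\psi\in L^\infty(A)$. Then a function $u\in\mathcal{W}^s_{\varphi,\psi}(\Omega,A)$ solves the obstacle problem (in $\Omega$, with exterior data $\varphi$ and obstacle $\psi$ in $A$) if and only if $$\langle\mathscr{H}_su,v-u\rangle\ge0\qquad\text{for all }v\in\mathcal{W}^s_{\varphi,\psi}(\Omega,A).$$ In particular, if $u\in\mathcal{W}^s_{\varphi,\psi}(\Omega,A)$ solves the obstacle problem, then: (i) $\langle\mathscr{H}_su,w\rangle\ge0$ for all $w\in C^\infty_c(\Omega)$ such that $w\ge0$; (ii) if $\mathcal{O}\subset\Omega$ is an open set such that $$\inf_{\mathcal{O}\cap A}(u-\psi)\ge\delta$$ for some $\delta>0$, then $$\langle\mathscr{H}_su,w\rangle=0\qquad\text{for all }w\in C^\infty_c(\mathcal{O}).$$ Furthermore, if $\mathcal{O}$ has Lipschitz boundary, then $u$ minimizes $\mathcal{F}_s$ in $\mathcal{W}^s_u(\mathcal{O})$.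
   Context: Set $g_s(t)=(1+t^2)^{-\frac{n+1+s}{2}}$, $G_s(t)=\int_0^t g_s(\tau)\,d\tau$, $\mathcal{G}_s(t)=\int_0^tG_s(\tau)\,d\tau$, and for an open set $\mathcal{O}$, $Q(\mathcal{O})=\mathbb{R}^{2n}\setminus(\mathbb{R}^n\setminus\mathcal{O})^2$. Functions are measurable and identified when equal a.e. $\mathcal{W}^s(\mathcal{O})$ is the set of $u:\mathbb{R}^n\to\mathbb{R}$ with $u|_{\mathcal{O}}\in W^{s,1}(\mathcal{O})$, i.e. $\|u\|_{L^1(\mathcal{O})}+\int_{\mathcal{O}}\int_{\mathcal{O}}\frac{|u(x)-u(y)|}{|x-y|^{n+s}}\,dx\,dy<\infty$; for $\phi:\mathbb{R}^n\to\mathbb{R}$, $\mathcal{W}^s_\phi(\mathcal{O})=\{u\in\mathcal{W}^s(\mathcal{O}):u=\phi\text{ on }\mathbb{R}^n\setminus\mathcal{O}\}$. For $A\subset\Omega$ open and $\psi\in L^\infty(A)$, $\mathcal{W}^s_{\varphi,\psi}(\Omega,A):=\{u\in\mathcal{W}^s_\varphi(\Omega):u\ge\psi\text{ a.e. in }A\}$. A function $u$ minimizes $\mathcal{F}_s$ in a class $\mathcal{K}\subset\mathcal{W}^s_\phi(\mathcal{O})$ if $u\in\mathcal{K}$ and for every $v\in\mathcal{K}$ $$\iint_{Q(\mathcal{O})}\left\{\mathcal{G}_s\Big(\tfrac{u(x)-u(y)}{|x-y|}\Big)-\mathcal{G}_s\Big(\tfrac{v(x)-v(y)}{|x-y|}\Big)\right\}\frac{dx\,dy}{|x-y|^{n-1+s}}\le0.$$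 A function $u$ solves the obstacle problem (in $\Omega$, with exterior data $\varphi$ and obstacle $\psi$ in $A$) if it minimizes $\mathcal{F}_s$ in $\mathcal{W}^s_{\varphi,\psi}(\Omega,A)$ (with $\mathcal{O}=\Omega$ in the formula above). The pairing is $$\langle\mathscr{H}_su,w\rangle:=\int_{\mathbb{R}^n}\int_{\mathbb{R}^n}G_s\Big(\frac{u(x)-u(y)}{|x-y|}\Big)\big(w(x)-w(y)\big)\frac{dx\,dy}{|x-y|^{n+s}}.$$ The infimum of a measurable function is understood as essential infimum. *)

theory Defs
  imports "HOL-Analysis.Analysis" "HOL-Probability.Essential_Supremum"
begin

definition g_s :: "nat \<Rightarrow> real \<Rightarrow> real \<Rightarrow> real" where
  "g_s n s t = (1 + t\<^sup>2) powr (- ((real n + 1 + s) / 2))"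

text \<open>Interval integrals are oriented, so the next two definitions also cover \<open>t < 0\<close>.\<close>

definition G_s :: "nat \<Rightarrow> real \<Rightarrow> real \<Rightarrow> real" where
  "G_s n s t = (LBINT \<tau>=ereal 0..ereal t. g_s n s \<tau>)"

definition cal_G_s :: "nat \<Rightarrow> real \<Rightarrow> real \<Rightarrow> real" where
  "cal_G_s n s t = (LBINT \<tau>=ereal 0..ereal t. G_s n s \<tau>)"

definition Q_set :: "'a set \<Rightarrow> ('a \<times> 'a) set" where
  "Q_set U = UNIV - (- U) \<times> (- U)"

text \<open>Near each boundary point the set is the strict epigraph, in some unit direction \<open>e\<close>, of a
  Lipschitz function on the hyperplane orthogonal to \<open>e\<close>. Since the dimension is a type, that
  hyperplane takes the place of \<open>\<real>\<^sup>n\<^sup>-\<^sup>1\<close> and the choice of \<open>e\<close> that of a rigid motion.\<close>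

definition lipschitz_boundary :: "'a::euclidean_space set \<Rightarrow> bool" where
  "lipschitz_boundary U \<longleftrightarrow>
     (\<forall>p\<in>frontier U. \<exists>r>0. \<exists>e L (\<gamma> :: 'a \<Rightarrow> real).
        norm e = 1 \<and> L-lipschitz_on {y. y \<bullet> e = 0} \<gamma> \<and>
        U \<inter> ball p r = {x \<in> ball p r. x \<bullet> e > \<gamma> (x - (x \<bullet> e) *\<^sub>R e)})"

text \<open>Functions are Lebesgue measurable, and equality and order between them are meant almost
  everywhere. Double integrals are taken with respect to Lebesgue measure on
  \<open>\<real>\<^sup>n \<times> \<real>\<^sup>n\<close>; the integrands take the value \<open>0\<close> on the (null) diagonal.\<close>

definition W_s :: "real \<Rightarrow> (real ^ 'n) set \<Rightarrow> (real ^ 'n \<Rightarrow> real) set" where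
  "W_s s U = {u \<in> borel_measurable lebesgue.
     set_integrable lebesgue U u \<and>
     set_integrable lebesgue (U \<times> U)
       (\<lambda>(x, y). \<bar>u x - u y\<bar> / norm (x - y) powr (real CARD('n) + s))}"

definition W_s_ext :: "real \<Rightarrow> (real ^ 'n \<Rightarrow> real) \<Rightarrow> (real ^ 'n) set \<Rightarrow> (real ^ 'n \<Rightarrow> real) set" where
  "W_s_ext s \<phi> U = {u \<in> W_s s U. AE x in lebesgue. x \<notin> U \<longrightarrow> u x = \<phi> x}"

definition W_s_obst ::
  "real \<Rightarrow> (real ^ 'n \<Rightarrow> real) \<Rightarrow> (real ^ 'n \<Rightarrow> real) \<Rightarrow> (real ^ 'n) set \<Rightarrow> (real ^ 'n) set
     \<Rightarrow> (real ^ 'n \<Rightarrow> real) set" where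
  "W_s_obst s \<phi> \<psi> \<Omega> A = {u \<in> W_s_ext s \<phi> \<Omega>. AE x in lebesgue. x \<in> A \<longrightarrow> \<psi> x \<le> u x}"

text \<open>Only the values of \<open>f\<close> on \<open>A\<close> matter.\<close>

definition L_infinity_on :: "'a::euclidean_space set \<Rightarrow> ('a \<Rightarrow> real) set" where
  "L_infinity_on A = {f \<in> borel_measurable (lebesgue_on A).
     esssup (lebesgue_on A) (\<lambda>x. ereal \<bar>f x\<bar>) < \<infinity>}"

text \<open>The essential infimum over a null set is \<open>\<infinity>\<close>.\<close>

definition essinf_on :: "'a::euclidean_space set \<Rightarrow> ('a \<Rightarrow> real) \<Rightarrow> ereal" where
  "essinf_on A f = - esssup (lebesgue_on A) (\<lambda>x. - ereal (f x))"

definition F_s_diff_integrand ::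
  "real \<Rightarrow> (real ^ 'n \<Rightarrow> real) \<Rightarrow> (real ^ 'n \<Rightarrow> real) \<Rightarrow> (real ^ 'n) \<times> (real ^ 'n) \<Rightarrow> real" where
  "F_s_diff_integrand s u v = (\<lambda>(x, y).
     (cal_G_s CARD('n) s ((u x - u y) / norm (x - y))
        - cal_G_s CARD('n) s ((v x - v y) / norm (x - y)))
     / norm (x - y) powr (real CARD('n) - 1 + s))"

text \<open>The integral of a non-integrable function is \<open>0\<close> by convention, so the
  convergence implicit in the inequality is required explicitly.\<close>

definition minimizes_F_s ::
  "real \<Rightarrow> (real ^ 'n) set \<Rightarrow> (real ^ 'n \<Rightarrow> real) set \<Rightarrow> (real ^ 'n \<Rightarrow> real) \<Rightarrow> bool" where
  "minimizes_F_s s U K u \<longleftrightarrow> u \<in> K \<and>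
     (\<forall>v\<in>K. set_integrable lebesgue (Q_set U) (F_s_diff_integrand s u v) \<and>
             (LINT z:Q_set U|lebesgue. F_s_diff_integrand s u v z) \<le> 0)"

definition solves_obstacle_problem ::
  "real \<Rightarrow> (real ^ 'n \<Rightarrow> real) \<Rightarrow> (real ^ 'n \<Rightarrow> real) \<Rightarrow> (real ^ 'n) set \<Rightarrow> (real ^ 'n) set
     \<Rightarrow> (real ^ 'n \<Rightarrow> real) \<Rightarrow> bool" where
  "solves_obstacle_problem s \<phi> \<psi> \<Omega> A u \<longleftrightarrow> minimizes_F_s s \<Omega> (W_s_obst s \<phi> \<psi> \<Omega> A) u"

definition H_s_integrand ::
  "real \<Rightarrow> (real ^ 'n \<Rightarrow> real) \<Rightarrow> (real ^ 'n \<Rightarrow> real) \<Rightarrow> (real ^ 'n) \<times> (real ^ 'n) \<Rightarrow> real" where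
  "H_s_integrand s u w = (\<lambda>(x, y).
     G_s CARD('n) s ((u x - u y) / norm (x - y)) * (w x - w y)
     / norm (x - y) powr (real CARD('n) + s))"

definition H_s_pairing :: "real \<Rightarrow> (real ^ 'n \<Rightarrow> real) \<Rightarrow> (real ^ 'n \<Rightarrow> real) \<Rightarrow> real" where
  "H_s_pairing s u w = integral\<^sup>L lebesgue (H_s_integrand s u w)"

definition H_s_pairing_converges ::
  "real \<Rightarrow> (real ^ 'n \<Rightarrow> real) \<Rightarrow> (real ^ 'n \<Rightarrow> real) \<Rightarrow> bool" where
  "H_s_pairing_converges s u w \<longleftrightarrow> integrable lebesgue (H_s_integrand s u w)"

text \<open>All directional derivatives of \<open>f\<close> are required to be \<open>C\<^sup>k\<close> for \<open>f\<close> to be \<open>C\<^sup>k\<^sup>+\<^sup>1\<close>.\<close>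

primrec C_k :: "nat \<Rightarrow> ('a::euclidean_space \<Rightarrow> real) \<Rightarrow> bool" where
  "C_k 0 f \<longleftrightarrow> continuous_on UNIV f"
| "C_k (Suc k) f \<longleftrightarrow> (\<forall>x. f differentiable (at x)) \<and>
     (\<forall>d. C_k k (\<lambda>x. frechet_derivative f (at x) d))"

definition Cc_infinity :: "'a::euclidean_space set \<Rightarrow> ('a \<Rightarrow> real) set" where
  "Cc_infinity U = {w. (\<forall>k. C_k k w) \<and> compact (closure {x. w x \<noteq> 0}) \<and> closure {x. w x \<noteq> 0} \<subseteq> U}"

end

theory Submission
  imports Defs
begin

text \<open>
  The energy density \<open>cal_G_s\<close> is convex, with bounded derivative \<open>G_s\<close>. The theorem is therefore the
  standard equivalence between minimality in a convex class and a variational inequality: the first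
  variation of the energy at \<open>u\<close> in the direction \<open>w\<close> is the pairing of \<open>u\<close> with \<open>w\<close>;
  convexity gives \<open>minimizes_F_s_of_pairing_nonneg\<close>, and differentiation under the integral gives \<open>pairing_nonneg_of_minimizes_F_s\<close>. All integrands are
  dominated by the Gagliardo integrand \<open>\<bar>w x - w y\<bar> / norm (x - y) powr (n + s)\<close> of the variation \<open>w\<close>.

  The analytic content is that this integrand is integrable over the whole product space, although
  the hypotheses give it only over \<open>\<Omega> \<times> \<Omega>\<close>. For \<open>w\<close> vanishing off \<open>\<Omega>\<close>, the interaction of \<open>\<Omega>\<close> with
  its complement is bounded by a multiple of the integral of \<open>\<bar>w\<bar>\<close> against the distance to the boundary to the
  power \<open>- s\<close>, so what is needed is the fractional Hardy inequality with exponent \<open>1\<close> on bounded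
  Lipschitz domains, true because \<open>s < 1\<close>. Its core is \<open>Hardy_one_scale\<close>: in a boundary chart the mass of
  \<open>\<bar>w\<bar>\<close> in a strip of height \<open>\<eta>\<close> along the boundary is at most \<open>1 / N\<close> times its mass in a strip of height
  \<open>(N + 3) \<eta>\<close>, plus a multiple of the Gagliardo seminorm on the scale \<open>\<eta>\<close>. Iterating this over geometric
  scales (\<open>Hardy_chart\<close>) and patching charts together gives \<open>Hardy_Lipschitz_domain\<close> and then the
  bound \<open>integrable_gagliardo_zero_extension\<close>.

  Where \<open>u\<close> stays above the obstacle by \<open>\<delta>\<close>, small bounded variations of both signs are admissible, so
  their pairing vanishes (\<open>pairing_eq_0_of_bounded\<close>); truncation and dominated convergence extend this to all
  variations of finite energy (\<open>pairing_eq_0\<close>). On a Lipschitz subdomain these include \<open>v - u\<close> for every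
  competitor \<open>v\<close>, and convexity again yields minimality there.
\<close>

section \<open>The profile functions\<close>

lemma continuous_g_s: "continuous_on S (g_s n s)"
proof -
  have "1 + t\<^sup>2 \<noteq> 0" for t :: real
    by (metis add_pos_nonneg less_irrefl zero_le_power2 zero_less_one)
  then show ?thesis
    unfolding g_s_def by (intro continuous_intros) auto
qed

lemma g_s_nonneg: "0 \<le> g_s n s t"
  by (simp add: g_s_def)

lemma g_s_le_arctan_derivative:
  assumes "0 \<le> s" "1 \<le> n"
  shows "g_s n s t \<le> inverse (1 + t\<^sup>2)"
proof -
  have "g_s n s t \<le> (1 + t\<^sup>2) powr (- 1)"
    unfolding g_s_def using assms by (intro powr_mono) auto
  also have "\<dots> = inverse (1 + t\<^sup>2)"
    by (simp add: powr_minus add_nonneg_nonneg)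
  finally show ?thesis .
qed

lemma has_real_derivative_interval_integral:
  fixes f :: "real \<Rightarrow> real"
  assumes "continuous_on UNIV f"
  shows "((\<lambda>t. LBINT \<tau>=ereal 0..ereal t. f \<tau>) has_real_derivative f t) (at t)"
proof -
  have "((\<lambda>u. LBINT y=ereal 0..ereal u. f y) has_vector_derivative f t)
      (at t within {- \<bar>t\<bar> - 1..\<bar>t\<bar> + 1})"
    by (rule interval_integral_FTC2) (auto intro: continuous_on_subset[OF assms])
  then have "((\<lambda>u. LBINT y=ereal 0..ereal u. f y) has_vector_derivative f t)
      (at t within {- \<bar>t\<bar> - 1<..<\<bar>t\<bar> + 1})"
    by (rule has_vector_derivative_within_subset) auto
  then show ?thesis
    by (subst (asm) has_vector_derivative_within_open)
       (auto simp: has_real_derivative_iff_has_vector_derivative)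
qed

lemma G_s_has_derivative: "(G_s n s has_real_derivative g_s n s t) (at t)"
  using has_real_derivative_interval_integral[OF continuous_g_s[of UNIV n s], of t]
  unfolding G_s_def[abs_def] by simp

lemma continuous_G_s: "continuous_on S (G_s n s)"
  using DERIV_isCont[OF G_s_has_derivative] by (intro continuous_at_imp_continuous_on) blast

lemma cal_G_s_has_derivative: "(cal_G_s n s has_real_derivative G_s n s t) (at t)"
  using has_real_derivative_interval_integral[OF continuous_G_s[of UNIV n s], of t]
  unfolding cal_G_s_def[abs_def] by simp

lemma continuous_cal_G_s: "continuous_on S (cal_G_s n s)"
  using DERIV_isCont[OF cal_G_s_has_derivative] by (intro continuous_at_imp_continuous_on) blast

lemma G_s_mono: "a \<le> b \<Longrightarrow> G_s n s a \<le> G_s n s b"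
  by (rule DERIV_nonneg_imp_nondecreasing) (use G_s_has_derivative g_s_nonneg in blast)+

text \<open>Since \<open>n + 1 + s \<ge> 2\<close>, the density \<open>g_s\<close> lies below the derivative of \<open>arctan\<close>, whose values
  stay in \<open>(-\<pi>/2, \<pi>/2)\<close>. The bound is what gives the functional linear growth.\<close>

lemma G_s_bounded:
  assumes "0 \<le> s" "1 \<le> n"
  shows "\<bar>G_s n s t\<bar> \<le> 2"
proof -
  let ?D = "\<lambda>t. arctan t - G_s n s t"
  have D: "(?D has_real_derivative inverse (1 + t\<^sup>2) - g_s n s t) (at t)" for t
    by (intro derivative_intros DERIV_arctan G_s_has_derivative)
  have mono: "?D a \<le> ?D b" if "a \<le> b" for a b
    using that
  proof (rule DERIV_nonneg_imp_nondecreasing)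
    fix t
    show "\<exists>y. (?D has_real_derivative y) (at t) \<and> 0 \<le> y"
      using D[of t] g_s_le_arctan_derivative[OF assms, of t] by (intro exI conjI) auto
  qed
  have G0: "G_s n s 0 = 0"
    by (simp add: G_s_def)
  have "\<bar>G_s n s t\<bar> \<le> \<bar>arctan t\<bar>"
    using mono[of 0 t] mono[of t 0] G_s_mono[of 0 t n s] G_s_mono[of t 0 n s] G0
    by (cases "0 \<le> t") auto
  also have "\<dots> \<le> 2"
    using arctan_bounded[of t] pi_less_4 by auto
  finally show ?thesis .
qed

lemma cal_G_s_lipschitz:
  assumes "0 \<le> s" "1 \<le> n"
  shows "\<bar>cal_G_s n s a - cal_G_s n s b\<bar> \<le> 2 * \<bar>a - b\<bar>"
proof -
  have "norm (cal_G_s n s a - cal_G_s n s b) \<le> 2 * norm (a - b)"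
    by (rule field_differentiable_bound[where S=UNIV and f' = "G_s n s"])
       (use G_s_bounded[OF assms] cal_G_s_has_derivative in auto)
  then show ?thesis by simp
qed

text \<open>\<open>cal_G_s\<close> lies above its tangents, because its derivative \<open>G_s\<close> is increasing.\<close>

lemma cal_G_s_convex: "cal_G_s n s a - cal_G_s n s b \<le> G_s n s a * (a - b)"
proof (cases a b rule: linorder_cases)
  case less
  then obtain z where "a < z" "z < b" "cal_G_s n s b - cal_G_s n s a = (b - a) * G_s n s z"
    using MVT2[of a b "cal_G_s n s" "G_s n s"] cal_G_s_has_derivative by blast
  moreover have "(b - a) * G_s n s a \<le> (b - a) * G_s n s z"
    using \<open>a < z\<close> less by (intro mult_left_mono G_s_mono) auto
  ultimately show ?thesis by (simp add: algebra_simps)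
next
  case greater
  then obtain z where "b < z" "z < a" "cal_G_s n s a - cal_G_s n s b = (a - b) * G_s n s z"
    using MVT2[of b a "cal_G_s n s" "G_s n s"] cal_G_s_has_derivative by blast
  moreover have "(a - b) * G_s n s z \<le> (a - b) * G_s n s a"
    using \<open>z < a\<close> greater by (intro mult_left_mono G_s_mono) auto
  ultimately show ?thesis by (simp add: algebra_simps)
qed auto

section \<open>Lebesgue measurable functions of one factor of a product\<close>

text \<open>The class of admissible functions is defined by Lebesgue measurability and null sets in
  \<open>\<real>\<^sup>n\<close>, whereas all double integrals use the completed measure on the product. A null set of one
  factor spans a null cylinder, so both notions pass to the product.\<close>

lemma AE_lebesgue_product:
  fixes P :: "'a::euclidean_space \<Rightarrow> bool" and Q :: "'b::euclidean_space \<Rightarrow> bool"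
  assumes "AE x in lebesgue. P x" "AE y in lebesgue. Q y"
  shows "AE z in (lebesgue :: ('a \<times> 'b) measure). P (fst z) \<and> Q (snd z)"
proof -
  obtain M where M: "M \<in> null_sets lborel" "{x. \<not> P x} \<subseteq> M"
    using assms(1) unfolding AE_completion_iff by (auto elim!: AE_E simp: null_sets_def)
  obtain N where N: "N \<in> null_sets lborel" "{y. \<not> Q y} \<subseteq> N"
    using assms(2) unfolding AE_completion_iff by (auto elim!: AE_E simp: null_sets_def)
  have "M \<times> (UNIV :: 'b set) \<in> null_sets (lborel \<Otimes>\<^sub>M lborel)"
    using M by (auto simp: null_sets_def lborel.emeasure_pair_measure_Times)
  moreover have "(UNIV :: 'a set) \<times> N \<in> null_sets (lborel \<Otimes>\<^sub>M lborel)"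
    using N by (auto simp: null_sets_def lborel.emeasure_pair_measure_Times)
  ultimately have "M \<times> UNIV \<union> UNIV \<times> N \<in> null_sets (lborel :: ('a \<times> 'b) measure)"
    unfolding lborel_prod by (rule null_sets.Un)
  then have "AE z in (lborel :: ('a \<times> 'b) measure). P (fst z) \<and> Q (snd z)"
    by (rule AE_I') (use M N in auto)
  then show ?thesis
    by (rule AE_completion)
qed

lemma borel_representative:
  fixes f :: "'a::euclidean_space \<Rightarrow> real"
  assumes "f \<in> borel_measurable lebesgue"
  obtains g where "g \<in> borel_measurable borel" "AE x in lebesgue. f x = g x"
proof -
  obtain g where "g \<in> borel_measurable lborel" "AE x in lborel. f x = g x"
    using completion_ex_borel_measurable_real[OF assms] by blast
  then show thesis
    by (intro that[of g]) (auto intro: AE_completion)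
qed

lemma lebesgue_measurable_of_AE_eq:
  fixes f g :: "'a::euclidean_space \<Rightarrow> real"
  assumes "g \<in> borel_measurable borel" "AE x in lebesgue. f x = g x"
  shows "f \<in> borel_measurable lebesgue"
proof (rule borel_measurable_AE)
  show "g \<in> borel_measurable lebesgue"
    using assms(1) by (simp add: measurable_completion)
  show "AE x in lebesgue. g x = f x"
    using assms(2) by eventually_elim simp
qed

lemma borel_measurable_lebesgue_fst_snd:
  fixes f :: "'a::euclidean_space \<Rightarrow> real"
  assumes "f \<in> borel_measurable lebesgue"
  shows "(\<lambda>z. f (fst z)) \<in> borel_measurable (lebesgue :: ('a \<times> 'b::euclidean_space) measure)"
    and "(\<lambda>z. f (snd z)) \<in> borel_measurable (lebesgue :: ('b::euclidean_space \<times> 'a) measure)"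
proof -
  obtain g where g: "g \<in> borel_measurable borel" "AE x in lebesgue. f x = g x"
    using borel_representative[OF assms] .
  have "AE z in (lebesgue :: ('a \<times> 'b) measure). f (fst z) = g (fst z)"
    using AE_lebesgue_product[OF g(2), of "\<lambda>_. True"] by simp
  moreover have "(\<lambda>z :: 'a \<times> 'b. g (fst z)) \<in> borel_measurable borel"
    by (rule measurable_compose[OF _ g(1)]) (intro borel_measurable_continuous_onI continuous_intros)
  ultimately show "(\<lambda>z. f (fst z)) \<in> borel_measurable (lebesgue :: ('a \<times> 'b) measure)"
    by (rule lebesgue_measurable_of_AE_eq[rotated])
  have "AE z in (lebesgue :: ('b \<times> 'a) measure). f (snd z) = g (snd z)"
    using AE_lebesgue_product[OF _ g(2), of "\<lambda>_. True"] by simp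
  moreover have "(\<lambda>z :: 'b \<times> 'a. g (snd z)) \<in> borel_measurable borel"
    by (rule measurable_compose[OF _ g(1)]) (intro borel_measurable_continuous_onI continuous_intros)
  ultimately show "(\<lambda>z. f (snd z)) \<in> borel_measurable (lebesgue :: ('b \<times> 'a) measure)"
    by (rule lebesgue_measurable_of_AE_eq[rotated])
qed

section \<open>Integrals of powers of the distance\<close>

text \<open>A function that is at most \<open>c k\<close> on a \<open>k\<close>-th shell, contained in a ball of radius \<open>\<rho> k\<close>, has
  integral at most the sum of the products of \<open>c k\<close> with the volumes of these balls. Overestimating
  shells by balls costs only a constant factor when the radii are geometric.\<close>

lemma nn_integral_le_geometric_balls:
  fixes f :: "'a::euclidean_space \<Rightarrow> ennreal" and \<rho> c :: "nat \<Rightarrow> real"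
  assumes nonneg: "\<And>k. 0 \<le> c k" "\<And>k. 0 \<le> \<rho> k"
    and covered: "\<And>z. f z \<noteq> 0 \<Longrightarrow> \<exists>k. norm z < \<rho> k \<and> f z \<le> ennreal (c k)"
    and geometric: "\<And>k. c k * (unit_ball_vol (DIM('a)) * \<rho> k ^ DIM('a)) = A * q ^ k"
    and q: "0 \<le> q" "q < 1"
  shows "(\<integral>\<^sup>+z. f z \<partial>lborel) \<le> ennreal (A / (1 - q))"
proof -
  let ?t = "\<lambda>k z. ennreal (c k) * indicator (ball (0::'a) (\<rho> k)) z"
  have le: "f z \<le> (\<Sum>k. ?t k z)" for z
  proof (cases "f z = 0")
    case False
    then obtain k where "norm z < \<rho> k" "f z \<le> ennreal (c k)"
      using covered by blast
    then have "f z \<le> ?t k z"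
      by (simp add: indicator_def)
    also have "\<dots> \<le> (\<Sum>k. ?t k z)"
      using sum_le_suminf[OF summableI, of "{k}" "\<lambda>k. ?t k z"]
      by (simp only: sum.insert finite.intros empty_iff not_False_eq_True sum.empty add_0_right) simp
    finally show ?thesis .
  qed simp
  have "(\<integral>\<^sup>+z. f z \<partial>lborel) \<le> (\<integral>\<^sup>+z. (\<Sum>k. ?t k z) \<partial>lborel)"
    by (rule nn_integral_mono) (rule le)
  also have "\<dots> = (\<Sum>k. ennreal (c k) * emeasure lborel (ball 0 (\<rho> k) :: 'a set))"
  proof -
    have "(\<integral>\<^sup>+z. ?t k z \<partial>lborel) = ennreal (c k) * emeasure lborel (ball 0 (\<rho> k) :: 'a set)" for k
      by (rule nn_integral_cmult_indicator) simp
    moreover have "(\<integral>\<^sup>+z. (\<Sum>k. ?t k z) \<partial>lborel) = (\<Sum>k. (\<integral>\<^sup>+z. ?t k z \<partial>lborel))"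
      by (rule nn_integral_suminf) (intro borel_measurable_times_ennreal borel_measurable_const borel_measurable_indicator, simp)
    ultimately show ?thesis
      by presburger
  qed
  also have "\<dots> = (\<Sum>k. ennreal (A * q ^ k))"
    using nonneg by (simp add: emeasure_ball ennreal_mult[symmetric] geometric)
  also have "\<dots> = ennreal (A / (1 - q))"
  proof (rule suminf_ennreal_eq)
    show "0 \<le> A * q ^ k" for k
      unfolding geometric[symmetric] using nonneg by simp
    show "(\<lambda>k. A * q ^ k) sums (A / (1 - q))"
      using sums_mult[OF geometric_sums[of q], of A] q by simp
  qed
  finally show ?thesis .
qed

text \<open>On the shell \<open>d * 2 ^ k \<le> norm z < d * 2 ^ Suc k\<close> the kernel is comparable to a constant, and the
  contributions of the shells form a geometric series of ratio \<open>2 powr - s\<close>.\<close>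

lemma nn_integral_kernel_outside_ball:
  assumes s: "0 < s"
  obtains C where "0 \<le> C" "\<And>d. 0 < d \<Longrightarrow>
    (\<integral>\<^sup>+z. ennreal (norm (z::'a::euclidean_space) powr - (real DIM('a) + s)) * indicator {z. d \<le> norm z} z \<partial>lborel)
      \<le> ennreal (C * d powr - s)"
proof -
  let ?n = "real DIM('a)"
  let ?V = "unit_ball_vol (DIM('a))"
  let ?q = "2 powr - s"
  have q: "0 \<le> ?q" "?q < 1"
    using s by (auto simp: powr_less_one)
  have "(\<integral>\<^sup>+z. ennreal (norm (z::'a) powr - (?n + s)) * indicator {z. d \<le> norm z} z \<partial>lborel)
      \<le> ennreal ((?V * 2 powr ?n * d powr - s) / (1 - ?q))" if d: "0 < d" for d
  proof (rule nn_integral_le_geometric_balls[where \<rho> = "\<lambda>k. d * 2 ^ Suc k"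
        and c = "\<lambda>k. (d * 2 ^ k) powr - (?n + s)"])
    fix z :: 'a
    assume "ennreal (norm z powr - (?n + s)) * indicator {z. d \<le> norm z} z \<noteq> 0"
    then have z: "d \<le> norm z"
      by (auto simp: indicator_def split: if_splits)
    obtain m where m: "norm z / d < 2 ^ m"
      using real_arch_pow[of 2 "norm z / d"] by auto
    define k where "k = (LEAST k. norm z < d * 2 ^ Suc k)"
    have ex: "norm z < d * 2 ^ Suc m"
    proof -
      have "norm z < d * 2 ^ m"
        using m d by (simp add: pos_divide_less_eq mult.commute)
      also have "\<dots> \<le> d * 2 ^ Suc m"
        using d by simp
      finally show ?thesis .
    qed
    have k: "norm z < d * 2 ^ Suc k"
      unfolding k_def by (rule LeastI[of _ m]) (rule ex)
    have k': "d * 2 ^ k \<le> norm z"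
    proof (cases k)
      case (Suc j)
      then have "\<not> norm z < d * 2 ^ Suc j"
        using not_less_Least[of j "\<lambda>k. norm z < d * 2 ^ Suc k"] unfolding k_def by auto
      with Suc show ?thesis by auto
    qed (use z in auto)
    have "norm z powr - (?n + s) \<le> (d * 2 ^ k) powr - (?n + s)"
      using k' d s by (intro powr_mono2') auto
    then have "ennreal (norm z powr - (?n + s)) * indicator {z. d \<le> norm z} z \<le> ennreal ((d * 2 ^ k) powr - (?n + s))"
      by (auto simp: indicator_def intro!: ennreal_leI)
    then show "\<exists>k. norm z < d * 2 ^ Suc k \<and>
        ennreal (norm z powr - (?n + s)) * indicator {z. d \<le> norm z} z \<le> ennreal ((d * 2 ^ k) powr - (?n + s))"
      using k by blast
  next
    fix k
    have pow2: "(2 ^ k :: real) powr - s = ?q ^ k"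
      by (simp add: powr_realpow[symmetric] powr_powr mult.commute)
    have "(d * 2 ^ Suc k) ^ DIM('a) = ((d * 2 ^ k) * 2) powr ?n"
      using d by (subst powr_realpow) (auto simp: mult_ac)
    also have "\<dots> = (d * 2 ^ k) powr ?n * 2 powr ?n"
      using d by (subst powr_mult) auto
    finally have ball: "(d * 2 ^ Suc k) ^ DIM('a) = (d * 2 ^ k) powr ?n * 2 powr ?n" .
    have "(d * 2 ^ k) powr - (?n + s) * (d * 2 ^ k) powr ?n = (d * 2 ^ k) powr - s"
      by (subst powr_add[symmetric]) simp
    also have "\<dots> = d powr - s * ?q ^ k"
      using d by (subst powr_mult) (auto simp: pow2)
    finally have "?V * 2 powr ?n * ((d * 2 ^ k) powr - (?n + s) * (d * 2 ^ k) powr ?n) =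
        ?V * 2 powr ?n * (d powr - s * ?q ^ k)"
      by (rule arg_cong)
    then show "(d * 2 ^ k) powr - (?n + s) * (?V * (d * 2 ^ Suc k) ^ DIM('a)) =
        (?V * 2 powr ?n * d powr - s) * ?q ^ k"
      unfolding ball by (simp only: mult_ac)
  qed (use d q in auto)
  then show thesis
    using q by (intro that[of "?V * 2 powr ?n / (1 - ?q)"]) auto
qed

text \<open>The exponent exceeds \<open>- n\<close> exactly because \<open>s < 1\<close>: the shells shrinking to the origin contribute a
  geometric series of ratio \<open>2 powr (s - 1)\<close>.\<close>

lemma nn_integral_kernel_unit_ball:
  assumes s: "0 < s" "s < 1"
  shows "(\<integral>\<^sup>+z. ennreal (norm (z::'a::euclidean_space) powr (1 - (real DIM('a) + s))) * indicator (ball 0 1 - {0}) z \<partial>lborel) < \<infinity>"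
proof -
  let ?n = "real DIM('a)"
  let ?V = "unit_ball_vol (DIM('a))"
  let ?q = "2 powr (s - 1)"
  let ?a = "1 - (?n + s)"
  have "1 \<le> ?n"
    using DIM_positive[where 'a='a] by linarith
  then have a: "?a \<le> 0"
    using s by linarith
  have q: "0 \<le> ?q" "?q < 1"
    using s by (auto simp: powr_less_one)
  have half: "(1/2 :: real) ^ k = 2 powr (- real k)" for k
    by (simp add: powr_minus powr_realpow power_one_over inverse_eq_divide)
  have "(\<integral>\<^sup>+z. ennreal (norm (z::'a) powr ?a) * indicator (ball 0 1 - {0}) z \<partial>lborel)
      \<le> ennreal ((?V * 2 powr - ?a) / (1 - ?q))"
  proof (rule nn_integral_le_geometric_balls[where \<rho> = "\<lambda>k. (1/2) ^ k"
        and c = "\<lambda>k. ((1/2) ^ Suc k) powr ?a"])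
    fix z :: 'a
    assume "ennreal (norm z powr ?a) * indicator (ball 0 1 - {0}) z \<noteq> 0"
    then have z: "0 < norm z" "norm z < 1"
      by (auto simp: indicator_def split: if_splits)
    obtain m where m: "(1/2) ^ m < norm z"
      using real_arch_pow_inv[of "norm z" "1/2"] z by auto
    define k where "k = (LEAST k. (1/2) ^ Suc k \<le> norm z)"
    have "(1/2 :: real) ^ Suc m \<le> (1/2) ^ m"
      by (rule power_decreasing) auto
    then have ex: "(1/2) ^ Suc m \<le> norm z"
      using m by linarith
    have k: "(1/2) ^ Suc k \<le> norm z"
      unfolding k_def by (rule LeastI[of _ m]) (rule ex)
    have k': "norm z < (1/2) ^ k"
    proof (cases k)
      case (Suc j)
      then have "\<not> (1/2) ^ Suc j \<le> norm z"
        using not_less_Least[of j "\<lambda>k. (1/2) ^ Suc k \<le> norm z"] unfolding k_def by auto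
      with Suc show ?thesis by auto
    qed (use z in auto)
    have "norm z powr ?a \<le> ((1/2) ^ Suc k) powr ?a"
      using k a by (intro powr_mono2') auto
    then have "ennreal (norm z powr ?a) * indicator (ball 0 1 - {0}) z \<le> ennreal (((1/2) ^ Suc k) powr ?a)"
      by (auto simp: indicator_def intro!: ennreal_leI)
    then show "\<exists>k. norm z < (1/2) ^ k \<and>
        ennreal (norm z powr ?a) * indicator (ball 0 1 - {0}) z \<le> ennreal (((1/2) ^ Suc k) powr ?a)"
      using k' by blast
  next
    fix k
    have "((1/2) ^ Suc k) powr ?a * ((1/2) ^ k) ^ DIM('a) = 2 powr (- real (Suc k) * ?a + - real k * ?n)"
      unfolding half powr_powr powr_add by (simp add: powr_power mult.commute)
    also have "- real (Suc k) * ?a + - real k * ?n = - ?a + (s - 1) * real k"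
      by (simp add: algebra_simps)
    also have "2 powr \<dots> = 2 powr - ?a * ?q ^ k"
      unfolding powr_add by (simp add: powr_power mult.commute)
    finally have "?V * (((1/2) ^ Suc k) powr ?a * ((1/2) ^ k) ^ DIM('a)) = ?V * (2 powr - ?a * ?q ^ k)"
      by (rule arg_cong)
    then show "((1/2) ^ Suc k) powr ?a * (?V * ((1/2) ^ k) ^ DIM('a)) = (?V * 2 powr - ?a) * ?q ^ k"
      by (simp only: mult_ac)
  qed (use q in auto)
  also have "\<dots> < \<infinity>"
    by simp
  finally show ?thesis .
qed

section \<open>The fractional Hardy inequality on a Lipschitz domain\<close>

definition gagliardo :: "real \<Rightarrow> ('a::euclidean_space \<Rightarrow> real) \<Rightarrow> 'a \<times> 'a \<Rightarrow> real" where
  "gagliardo s w = (\<lambda>(x, y). \<bar>w x - w y\<bar> / norm (x - y) powr (real DIM('a) + s))"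

lemma gagliardo_nonneg: "0 \<le> gagliardo s w z"
  by (simp add: gagliardo_def split: prod.split)

lemma borel_measurable_gagliardo [measurable]:
  fixes w :: "'a::euclidean_space \<Rightarrow> real"
  assumes [measurable]: "w \<in> borel_measurable borel"
  shows "gagliardo s w \<in> borel_measurable (borel \<Otimes>\<^sub>M borel)"
  unfolding gagliardo_def by measurable

lemma nn_integral_translate:
  fixes f :: "'a::euclidean_space \<Rightarrow> ennreal"
  assumes [measurable]: "f \<in> borel_measurable borel"
  shows "(\<integral>\<^sup>+x. f (x + a) \<partial>lborel) = (\<integral>\<^sup>+x. f x \<partial>lborel)"
proof -
  have "(\<integral>\<^sup>+x. f x \<partial>lborel) = (\<integral>\<^sup>+x. f x \<partial>distr lborel borel ((+) a))"
    by (simp only: lborel_distr_plus)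
  also have "\<dots> = (\<integral>\<^sup>+x. f (a + x) \<partial>lborel)"
    by (rule nn_integral_distr) auto
  finally show ?thesis
    by (simp add: add.commute)
qed

text \<open>In a boundary chart, \<open>h\<close> is the height over the boundary; these are the points of a ball that
  lie at height at most \<open>\<eta>\<close> inside the domain.\<close>

definition strip :: "('a::euclidean_space \<Rightarrow> real) \<Rightarrow> 'a \<Rightarrow> real \<Rightarrow> real \<Rightarrow> 'a set" where
  "strip h p R \<eta> = {x \<in> ball p R. 0 < h x \<and> h x \<le> \<eta>}"

text \<open>A point \<open>x\<close> of the strip of height \<open>\<eta>\<close> is compared with the points \<open>x + v + j \<eta> e\<close> for
  \<open>j = 2, \<dots>, N + 1\<close> and small \<open>v\<close>. All of these lie in the domain, at distance comparable to \<open>\<eta>\<close> from \<open>x\<close>, so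
  the differences are controlled by the Gagliardo seminorm on that scale. For fixed \<open>v\<close> the \<open>N\<close> translates
  of the strip are disjoint, since the height of \<open>y - v\<close> for \<open>y\<close> in the \<open>j\<close>-th one lies between \<open>j \<eta>\<close>
  (excluded) and \<open>(j + 1) \<eta>\<close>; hence the
  values \<open>w (x + v + j \<eta> e)\<close> together contribute the mass of a strip of height \<open>(N + 3) \<eta>\<close> only once,
  and averaging over \<open>j\<close> produces the factor \<open>1 / N\<close>. That factor makes the estimate useful: the weight
  \<open>\<eta> powr - s\<close> changes only by \<open>(N + 3) powr s\<close> between the two strips, which is smaller than \<open>N\<close> for
  large \<open>N\<close>.\<close>

lemma Hardy_one_scale:
  fixes w h :: "'a::euclidean_space \<Rightarrow> real" and e p :: 'a and U :: "'a set"
  assumes w [measurable]: "w \<in> borel_measurable borel"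
    and h [measurable]: "h \<in> borel_measurable borel"
    and lip: "\<And>x y. \<bar>h x - h y\<bar> \<le> L * norm (x - y)"
    and shift: "\<And>x t. h (x + t *\<^sub>R e) = h x + t" and e: "norm e = 1"
    and L: "1 \<le> L" and s: "0 < s" and \<eta>: "0 < \<eta>" and N: "1 \<le> N"
    and U: "\<And>x. x \<in> ball p (R + (real N + 2) * \<eta>) \<Longrightarrow> 0 < h x \<Longrightarrow> x \<in> U"
    and [measurable]: "U \<in> sets borel"
  defines "n \<equiv> real DIM('a)"
  shows "(\<integral>\<^sup>+x. ennreal \<bar>w x\<bar> * indicator (strip h p R \<eta>) x \<partial>lborel)
    \<le> ennreal (1 / real N) * (\<integral>\<^sup>+x. ennreal \<bar>w x\<bar> * indicator (strip h p (R + (real N + 2) * \<eta>) ((real N + 3) * \<eta>)) x \<partial>lborel)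
    + ennreal ((real N + 2) powr (n + s) * (2 * L) powr n / unit_ball_vol n * \<eta> powr s) *
      (\<integral>\<^sup>+z. ennreal (gagliardo s w z) *
        indicator {(x, y). x \<in> U \<and> y \<in> U \<and> \<eta> \<le> norm (x - y) \<and> norm (x - y) < (real N + 2) * \<eta>} z \<partial>(lborel \<Otimes>\<^sub>M lborel))"
    (is "?m \<le> ennreal (1 / real N) * ?m' + _ * ?I")
proof -
  let ?V = "strip h p R \<eta>"
  let ?V' = "strip h p (R + (real N + 2) * \<eta>) ((real N + 3) * \<eta>)"
  let ?J = "{2..N + 1}"
  let ?r = "\<eta> / (2 * L)"
  define B where "B = ball (0::'a) ?r"
  let ?D = "{(x, y). x \<in> U \<and> y \<in> U \<and> \<eta> \<le> norm (x - y) \<and> norm (x - y) < (real N + 2) * \<eta>}"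
  let ?K = "((real N + 2) * \<eta>) powr (n + s)"
  define \<beta> where "\<beta> = unit_ball_vol n * ?r powr n"
  define y where "y = (\<lambda>x v j. x + (v + (real j * \<eta>) *\<^sub>R e))"
  have r: "0 < ?r" using \<eta> L by simp
  have \<beta>: "0 < \<beta>" "emeasure lborel B = ennreal \<beta>"
    using r by (auto simp: B_def \<beta>_def n_def emeasure_ball powr_realpow intro!: mult_pos_pos)
  have [measurable]: "B \<in> sets borel" "?V \<in> sets borel" "?V' \<in> sets borel"
    unfolding strip_def B_def by auto
  have "?D = {z \<in> space (borel \<Otimes>\<^sub>M borel). fst z \<in> U \<and> snd z \<in> U \<and>
      \<eta> \<le> norm (fst z - snd z) \<and> norm (fst z - snd z) < (real N + 2) * \<eta>}"
    by (auto simp: space_pair_measure)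
  also have "\<dots> \<in> sets (borel \<Otimes>\<^sub>M borel)"
    by measurable
  finally have [measurable]: "?D \<in> sets (borel \<Otimes>\<^sub>M borel)" .
  \<comment> \<open>The perturbation \<open>v\<close> changes the height by less than \<open>\<eta> / 2\<close>, so starting at \<open>j = 2\<close> keeps
    \<open>y x v j\<close> inside the domain and at distance at least \<open>\<eta>\<close> from \<open>x\<close>.\<close>
  have geom: "y x v j \<in> ?V'" "(x, y x v j) \<in> ?D" if x: "x \<in> ?V" and v: "v \<in> B" and j: "j \<in> ?J" for x v j
  proof -
    have "norm v < \<eta> / (2 * L)"
      using v by (simp add: B_def)
    then have Lv: "L * norm v < \<eta> / 2"
      using L by (simp add: pos_less_divide_eq mult_ac)
    moreover have "1 * norm v \<le> L * norm v"
      using L by (intro mult_right_mono) auto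
    ultimately have nv: "norm v < \<eta> / 2"
      by linarith
    have j': "2 * \<eta> \<le> real j * \<eta>" "real j * \<eta> \<le> (real N + 1) * \<eta>"
      using j \<eta> by (auto intro!: mult_right_mono)
    have hy: "h (y x v j) = h (x + v) + real j * \<eta>"
      unfolding y_def by (metis add.assoc shift)
    have "\<bar>h (x + v) - h x\<bar> < \<eta> / 2"
      using lip[of "x + v" x] Lv by simp
    then have hy': "0 < h (y x v j)" "h (y x v j) \<le> (real N + 3) * \<eta>"
    proof -
      have "0 < h x" "h x \<le> \<eta>"
        using x by (auto simp: strip_def)
      moreover have "(real N + 3) * \<eta> = (real N + 1) * \<eta> + 2 * \<eta>"
        by (simp add: algebra_simps)
      ultimately show "0 < h (y x v j)" "h (y x v j) \<le> (real N + 3) * \<eta>"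
        unfolding hy using j' \<eta> \<open>\<bar>h (x + v) - h x\<bar> < \<eta> / 2\<close> by linarith+
    qed
    have nj: "norm ((real j * \<eta>) *\<^sub>R e) = real j * \<eta>"
      using \<eta> e by simp
    have "x - y x v j = - (v + (real j * \<eta>) *\<^sub>R e)"
      by (simp add: y_def)
    then have nxy: "norm (x - y x v j) = norm (v + (real j * \<eta>) *\<^sub>R e)"
      by (simp only: norm_minus_cancel)
    have d: "\<eta> \<le> norm (x - y x v j)" "norm (x - y x v j) < (real N + 2) * \<eta>"
    proof -
      have "(real N + 2) * \<eta> = (real N + 1) * \<eta> + \<eta>"
        by (simp add: algebra_simps)
      then show "\<eta> \<le> norm (x - y x v j)" "norm (x - y x v j) < (real N + 2) * \<eta>"
        unfolding nxy
        using norm_triangle_ineq[of v "(real j * \<eta>) *\<^sub>R e"] norm_diff_ineq[of "(real j * \<eta>) *\<^sub>R e" v]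
          nj nv j' \<eta> by (auto simp only: add.commute[of v])
    qed
    have "dist p x < R"
      using x by (simp add: strip_def)
    then have b: "y x v j \<in> ball p (R + (real N + 2) * \<eta>)"
      using d(2) dist_triangle[of p "y x v j" x] by (simp add: dist_norm)
    show "y x v j \<in> ?V'"
      using b hy' by (simp add: strip_def)
    have "x \<in> U"
    proof (rule U)
      have "0 \<le> (real N + 2) * \<eta>"
        using \<eta> by simp
      then show "x \<in> ball p (R + (real N + 2) * \<eta>)"
        using \<open>dist p x < R\<close> by simp
      show "0 < h x"
        using x by (simp add: strip_def)
    qed
    moreover have "y x v j \<in> U"
      using b hy'(1) by (rule U)
    ultimately show "(x, y x v j) \<in> ?D"
      using d by simp
  qed
  \<comment> \<open>Integrating \<open>\<bar>w x\<bar> \<le> \<bar>w y\<bar> + \<bar>w x - w y\<bar>\<close> over \<open>x\<close>, \<open>v\<close> and \<open>j\<close>: \<open>F\<close> collects the values,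
    \<open>E\<close> the differences.\<close>
  define F where "F = (\<lambda>x v. \<Sum>j\<in>?J. ennreal \<bar>w (y x v j)\<bar> * (indicator ?V x * indicator B v))"
  define E where "E = (\<lambda>x v. \<Sum>j\<in>?J. ennreal \<bar>w x - w (y x v j)\<bar> * (indicator ?V x * indicator B v))"
  have [measurable]: "(\<lambda>(x, v). F x v) \<in> borel_measurable (borel \<Otimes>\<^sub>M borel)"
    unfolding F_def y_def by measurable
  have [measurable]: "(\<lambda>(x, v). E x v) \<in> borel_measurable (borel \<Otimes>\<^sub>M borel)"
    unfolding E_def y_def by measurable
  have "(\<integral>\<^sup>+v. of_nat N * (ennreal \<bar>w x\<bar> * (indicator ?V x * indicator B v)) \<partial>lborel)
      = ennreal (real N * \<beta>) * (ennreal \<bar>w x\<bar> * indicator ?V x)" for x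
  proof -
    have "(\<integral>\<^sup>+v. of_nat N * (ennreal \<bar>w x\<bar> * (indicator ?V x * indicator B v)) \<partial>lborel)
      = (\<integral>\<^sup>+v. (of_nat N * (ennreal \<bar>w x\<bar> * indicator ?V x)) * indicator B v \<partial>lborel)"
      by (simp only: mult.assoc)
    also have "\<dots> = (of_nat N * (ennreal \<bar>w x\<bar> * indicator ?V x)) * ennreal \<beta>"
      by (subst nn_integral_cmult_indicator) (simp_all add: \<beta>)
    also have "\<dots> = ennreal (real N * \<beta>) * (ennreal \<bar>w x\<bar> * indicator ?V x)"
      using \<beta>(1) by (simp only: ennreal_of_nat_eq_real_of_nat ennreal_mult of_nat_0_le_iff less_imp_le mult_ac)
    finally show ?thesis .
  qed
  then have "ennreal (real N * \<beta>) * ?m = (\<integral>\<^sup>+x. (\<integral>\<^sup>+v. of_nat N * (ennreal \<bar>w x\<bar> * (indicator ?V x * indicator B v)) \<partial>lborel) \<partial>lborel)"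
    by (simp only:) (subst nn_integral_cmult, auto)
  also have "\<dots> \<le> (\<integral>\<^sup>+x. (\<integral>\<^sup>+v. F x v + E x v \<partial>lborel) \<partial>lborel)"
  proof (intro nn_integral_mono)
    fix x v
    have "of_nat N * (ennreal \<bar>w x\<bar> * (indicator ?V x * indicator B v)) =
      (\<Sum>j\<in>?J. ennreal \<bar>w x\<bar> * (indicator ?V x * indicator B v))"
      by simp
    also have "\<dots> \<le> (\<Sum>j\<in>?J. (ennreal \<bar>w (y x v j)\<bar> + ennreal \<bar>w x - w (y x v j)\<bar>) * (indicator ?V x * indicator B v))"
      by (intro sum_mono mult_right_mono) (auto simp flip: ennreal_plus intro!: ennreal_leI)
    finally show "of_nat N * (ennreal \<bar>w x\<bar> * (indicator ?V x * indicator B v)) \<le> F x v + E x v"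
      by (simp add: F_def E_def distrib_right sum.distrib)
  qed
  also have "\<dots> = (\<integral>\<^sup>+x. (\<integral>\<^sup>+v. F x v \<partial>lborel) \<partial>lborel) + (\<integral>\<^sup>+x. (\<integral>\<^sup>+v. E x v \<partial>lborel) \<partial>lborel)"
    by (simp add: nn_integral_add)
  finally have split: "ennreal (real N * \<beta>) * ?m \<le> (\<integral>\<^sup>+x. (\<integral>\<^sup>+v. F x v \<partial>lborel) \<partial>lborel) + (\<integral>\<^sup>+x. (\<integral>\<^sup>+v. E x v \<partial>lborel) \<partial>lborel)" .
  have "(\<integral>\<^sup>+x. (\<integral>\<^sup>+v. F x v \<partial>lborel) \<partial>lborel) = (\<integral>\<^sup>+v. (\<integral>\<^sup>+x. F x v \<partial>lborel) \<partial>lborel)"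
    by (rule lborel_pair.Fubini'[symmetric]) measurable
  also have "\<dots> \<le> (\<integral>\<^sup>+v. ?m' * indicator B v \<partial>lborel)"
  proof (rule nn_integral_mono)
    fix v :: 'a
    let ?a = "\<lambda>j. v + (real j * \<eta>) *\<^sub>R e"
    show "(\<integral>\<^sup>+x. F x v \<partial>lborel) \<le> ?m' * indicator B v"
    proof (cases "v \<in> B")
      case True
      have "(\<integral>\<^sup>+x. F x v \<partial>lborel) = (\<Sum>j\<in>?J. (\<integral>\<^sup>+x. ennreal \<bar>w (x + ?a j)\<bar> * indicator ?V (x + ?a j - ?a j) \<partial>lborel))"
        unfolding F_def y_def using True by (subst nn_integral_sum) auto
      also have "\<dots> = (\<Sum>j\<in>?J. (\<integral>\<^sup>+x. ennreal \<bar>w x\<bar> * indicator ?V (x - ?a j) \<partial>lborel))"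
        by (intro sum.cong refl nn_integral_translate) measurable
      also have "\<dots> = (\<integral>\<^sup>+x. (\<Sum>j\<in>?J. ennreal \<bar>w x\<bar> * indicator ?V (x - ?a j)) \<partial>lborel)"
        by (subst nn_integral_sum) auto
      also have "\<dots> \<le> ?m'"
      proof (rule nn_integral_mono)
        fix x
        \<comment> \<open>At most one translate of the strip contains \<open>x\<close>.\<close>
        show "(\<Sum>j\<in>?J. ennreal \<bar>w x\<bar> * indicator ?V (x - ?a j)) \<le> ennreal \<bar>w x\<bar> * indicator ?V' x"
        proof (cases "\<exists>j\<in>?J. x - ?a j \<in> ?V")
          case ex: True
          then obtain j where j: "j \<in> ?J" "x - ?a j \<in> ?V" by blast
          have h_eq: "h (x - ?a i) = h (x - v) - real i * \<eta>" for i
            using shift[of "x - ?a i" "real i * \<eta>"] by (simp add: algebra_simps)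
          have unique: "i = j" if "x - ?a i \<in> ?V" for i
          proof -
            have "0 < h (x - v) - real i * \<eta>" "h (x - v) - real i * \<eta> \<le> \<eta>"
              "0 < h (x - v) - real j * \<eta>" "h (x - v) - real j * \<eta> \<le> \<eta>"
              using that j(2) unfolding strip_def mem_Collect_eq h_eq by auto
            then have "real i * \<eta> < (real j + 1) * \<eta>" "real j * \<eta> < (real i + 1) * \<eta>"
              by (auto simp: algebra_simps)
            then have "real i < real j + 1" "real j < real i + 1"
              using \<eta> by (auto simp: mult_less_cancel_right)
            then show "i = j" by linarith
          qed
          have ind: "indicator ?V (x - ?a i) = (if i = j then 1 else 0 :: ennreal)" for i
          proof (cases "i = j")
            case True
            then show ?thesis using j(2) by simp
          next
            case False
            then have "x - ?a i \<notin> ?V" using unique by blast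
            with False show ?thesis by simp
          qed
          have "(\<Sum>i\<in>?J. ennreal \<bar>w x\<bar> * indicator ?V (x - ?a i)) = (\<Sum>i\<in>?J. if i = j then ennreal \<bar>w x\<bar> else 0)"
            unfolding ind by (intro sum.cong) auto
          also have "\<dots> = ennreal \<bar>w x\<bar>"
            using j(1) by simp
          finally have "(\<Sum>i\<in>?J. ennreal \<bar>w x\<bar> * indicator ?V (x - ?a i)) = ennreal \<bar>w x\<bar>" .
          moreover have "x \<in> ?V'"
            using geom(1)[OF j(2) True j(1)] by (simp add: y_def)
          ultimately show ?thesis by simp
        qed (auto simp: indicator_def intro!: sum_nonpos)
      qed
      finally show ?thesis
        using True by simp
    next
      case False
      then have "F x v = 0" for x
        unfolding F_def by (intro sum.neutral) auto
      then show ?thesis by simp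
    qed
  qed
  also have "\<dots> = ?m' * ennreal \<beta>"
    by (subst nn_integral_cmult_indicator) (simp_all add: \<beta>)
  finally have boundF: "(\<integral>\<^sup>+x. (\<integral>\<^sup>+v. F x v \<partial>lborel) \<partial>lborel) \<le> ?m' * ennreal \<beta>" .
  have "(\<integral>\<^sup>+x. (\<integral>\<^sup>+v. E x v \<partial>lborel) \<partial>lborel) \<le>
    (\<integral>\<^sup>+x. ennreal (real N * ?K) * (\<integral>\<^sup>+y. ennreal (gagliardo s w (x, y)) * indicator ?D (x, y) \<partial>lborel) \<partial>lborel)"
  proof (rule nn_integral_mono)
    fix x
    let ?g = "\<lambda>y. ennreal ?K * (ennreal (gagliardo s w (x, y)) * indicator ?D (x, y))"
    have "(\<integral>\<^sup>+v. E x v \<partial>lborel) \<le> (\<integral>\<^sup>+v. (\<Sum>j\<in>?J. ?g (v + (x + (real j * \<eta>) *\<^sub>R e))) \<partial>lborel)"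
    proof (rule nn_integral_mono, unfold E_def, rule sum_mono)
      fix v j assume j: "j \<in> ?J"
      have y_eq: "v + (x + (real j * \<eta>) *\<^sub>R e) = y x v j"
        by (simp add: y_def)
      show "ennreal \<bar>w x - w (y x v j)\<bar> * (indicator ?V x * indicator B v) \<le> ?g (v + (x + (real j * \<eta>) *\<^sub>R e))"
      proof (cases "x \<in> ?V \<and> v \<in> B")
        case True
        then have D: "(x, y x v j) \<in> ?D"
          using geom(2) j by blast
        then have d: "0 < norm (x - y x v j)" "norm (x - y x v j) < (real N + 2) * \<eta>"
          using \<eta> by auto
        have "\<bar>w x - w (y x v j)\<bar> = norm (x - y x v j) powr (n + s) * gagliardo s w (x, y x v j)"
          using d(1) by (simp add: gagliardo_def n_def)
        also have "\<dots> \<le> ?K * gagliardo s w (x, y x v j)"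
          using d s by (intro mult_right_mono powr_mono2 gagliardo_nonneg) (auto simp: n_def)
        finally have "ennreal \<bar>w x - w (y x v j)\<bar> \<le> ennreal ?K * ennreal (gagliardo s w (x, y x v j))"
          by (simp add: ennreal_leI gagliardo_nonneg flip: ennreal_mult)
        then show ?thesis
          using True D unfolding y_eq by simp
      qed auto
    qed
    also have "\<dots> = (\<Sum>j\<in>?J. (\<integral>\<^sup>+v. ?g (v + (x + (real j * \<eta>) *\<^sub>R e)) \<partial>lborel))"
      by (rule nn_integral_sum) measurable
    also have "\<dots> = (\<Sum>j\<in>?J. (\<integral>\<^sup>+v. ?g v \<partial>lborel))"
      by (intro sum.cong refl nn_integral_translate) measurable
    also have "\<dots> = of_nat N * (ennreal ?K * (\<integral>\<^sup>+v. ennreal (gagliardo s w (x, v)) * indicator ?D (x, v) \<partial>lborel))"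
      by (subst nn_integral_cmult) auto
    finally show "(\<integral>\<^sup>+v. E x v \<partial>lborel) \<le> ennreal (real N * ?K) * (\<integral>\<^sup>+y. ennreal (gagliardo s w (x, y)) * indicator ?D (x, y) \<partial>lborel)"
      by (simp add: ennreal_mult ennreal_of_nat_eq_real_of_nat mult.assoc)
  qed
  also have "\<dots> = ennreal (real N * ?K) * ?I"
  proof -
    have "(\<lambda>z. ennreal (gagliardo s w z) * indicator ?D z) \<in> borel_measurable (lborel \<Otimes>\<^sub>M lborel)"
      by measurable
    from lborel.nn_integral_fst[OF this] lborel.borel_measurable_nn_integral_fst[OF this]
    show ?thesis
      by (simp add: nn_integral_cmult)
  qed
  finally have main: "ennreal (real N * \<beta>) * ?m \<le> ?m' * ennreal \<beta> + ennreal (real N * ?K) * ?I"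
    using split boundF by (meson add_mono order_trans)
  have N\<beta>: "0 < real N * \<beta>" using N \<beta>(1) by simp
  then have "ennreal (1 / (real N * \<beta>)) * ennreal (real N * \<beta>) = 1"
    using N \<beta>(1) by (subst ennreal_mult[symmetric]) auto
  then have "?m = ennreal (1 / (real N * \<beta>)) * (ennreal (real N * \<beta>) * ?m)"
    by (simp only: mult.assoc[symmetric] mult_1)
  also have "\<dots> \<le> ennreal (1 / (real N * \<beta>)) * (?m' * ennreal \<beta> + ennreal (real N * ?K) * ?I)"
    by (intro mult_left_mono main) simp
  also have "\<dots> = (ennreal (1 / (real N * \<beta>)) * ennreal \<beta>) * ?m' + (ennreal (1 / (real N * \<beta>)) * ennreal (real N * ?K)) * ?I"
    by (simp only: distrib_left mult_ac)
  also have "ennreal (1 / (real N * \<beta>)) * ennreal \<beta> = ennreal (1 / real N)"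
    using \<beta>(1) N by (subst ennreal_mult[symmetric]) auto
  also have "ennreal (1 / (real N * \<beta>)) * ennreal (real N * ?K) = ennreal (?K / \<beta>)"
    using \<beta>(1) N by (subst ennreal_mult[symmetric]) auto
  also have "?K / \<beta> = (real N + 2) powr (n + s) * (2 * L) powr n / unit_ball_vol n * \<eta> powr s"
    using \<eta> L unfolding \<beta>_def by (simp add: powr_mult powr_divide powr_add)
  finally show ?thesis .
qed

text \<open>The only place where \<open>s < 1\<close> enters the Hardy inequality: \<open>N\<close> grows faster than \<open>N powr s\<close>.\<close>

lemma exists_Hardy_scale:
  assumes "0 < s" "s < 1"
  obtains N :: nat where "1 \<le> N" "(real N + 3) powr s / real N \<le> 1 / 2"
proof -
  define N where "N = nat \<lceil>8 powr (1 / (1 - s))\<rceil>"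
  have N8: "8 powr (1 / (1 - s)) \<le> real N"
    unfolding N_def by linarith
  have "1 \<le> 8 powr (1 / (1 - s))"
    using assms by (intro ge_one_powr_ge_zero) auto
  then have N: "1 \<le> real N"
    using N8 by linarith
  have "8 = (8 powr (1 / (1 - s))) powr (1 - s)"
    using assms by (simp add: powr_powr)
  also have "\<dots> \<le> real N powr (1 - s)"
    using N8 assms by (intro powr_mono2) auto
  finally have *: "8 * real N powr s \<le> real N"
    using N by (simp add: powr_diff pos_le_divide_eq)
  have "(real N + 3) powr s \<le> (4 * real N) powr s"
    using N assms by (intro powr_mono2) auto
  also have "\<dots> = 4 powr s * real N powr s"
    using N by (simp add: powr_mult)
  also have "\<dots> \<le> 4 powr 1 * real N powr s"
    using assms by (intro mult_right_mono powr_mono) auto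
  finally have "(real N + 3) powr s / real N \<le> 1 / 2"
    using * N by (simp add: field_simps)
  with N show thesis
    by (intro that[of N]) auto
qed

text \<open>The one-scale estimate is iterated along \<open>\<eta> k = (r / 2) / (N + 3) ^ k\<close>, in balls of radius
  \<open>r / 2 + \<eta> k\<close> that absorb the displacement of each step. For the weighted masses
  \<open>b k = \<eta> k powr - s * m k\<close> it reads \<open>b (k + 1) \<le> b k / 2 + C * \<epsilon> (k + 1)\<close>, and the \<open>\<epsilon> k\<close> have a
  finite sum because they integrate over disjoint ranges of \<open>norm (x - y)\<close>. So \<open>b\<close> is summable, and the
  weight \<open>h powr - s\<close> is dominated by the corresponding sum over strips. Working with a recursion
  avoids absorbing a term into the left side before it is known to be finite.\<close>

lemma Hardy_chart:
  fixes w h :: "'a::euclidean_space \<Rightarrow> real" and e p :: 'a and U :: "'a set"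
  assumes w [measurable]: "w \<in> borel_measurable borel"
    and h [measurable]: "h \<in> borel_measurable borel"
    and lip: "\<And>x y. \<bar>h x - h y\<bar> \<le> L * norm (x - y)"
    and shift: "\<And>x t. h (x + t *\<^sub>R e) = h x + t" and e: "norm e = 1"
    and L: "1 \<le> L" and s: "0 < s" "s < 1" and r: "0 < r"
    and U: "\<And>x. x \<in> ball p r \<Longrightarrow> 0 < h x \<Longrightarrow> x \<in> U"
    and Ub [measurable]: "U \<in> sets borel"
    and w1: "(\<integral>\<^sup>+x. ennreal \<bar>w x\<bar> * indicator U x \<partial>lborel) < \<infinity>"
    and w2: "(\<integral>\<^sup>+z. ennreal (gagliardo s w z) * indicator (U \<times> U) z \<partial>(lborel \<Otimes>\<^sub>M lborel)) < \<infinity>"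
  shows "(\<integral>\<^sup>+x. ennreal \<bar>w x\<bar> * (ennreal (h x powr - s) * indicator {x \<in> ball p (r / 2). 0 < h x} x) \<partial>lborel) < \<infinity>"
proof -
  obtain N where N: "1 \<le> N" "(real N + 3) powr s / real N \<le> 1 / 2"
    using exists_Hardy_scale[OF s] .
  define \<eta> where "\<eta> k = r / 2 / (real N + 3) ^ k" for k
  define R where "R k = r / 2 + \<eta> k" for k
  define m where "m k = (\<integral>\<^sup>+x. ennreal \<bar>w x\<bar> * indicator (strip h p (R k) (\<eta> k)) x \<partial>lborel)" for k
  define D where "D k = {(x, y). x \<in> U \<and> y \<in> U \<and> \<eta> k \<le> norm (x - y) \<and> norm (x - y) < (real N + 2) * \<eta> k}" for k
  define \<epsilon> where "\<epsilon> k = (\<integral>\<^sup>+z. ennreal (gagliardo s w z) * indicator (D k) z \<partial>(lborel \<Otimes>\<^sub>M lborel))" for k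
  define C where "C = (real N + 2) powr (real DIM('a) + s) * (2 * L) powr (real DIM('a)) / unit_ball_vol (real DIM('a))"
  define b where "b k = ennreal (\<eta> k powr - s) * m k" for k
  define E where "E = (\<integral>\<^sup>+z. ennreal (gagliardo s w z) * indicator (U \<times> U) z \<partial>(lborel \<Otimes>\<^sub>M lborel))"
  have \<eta>_pos: "0 < \<eta> k" for k
    using r by (simp add: \<eta>_def)
  have \<eta>_Suc: "(real N + 3) * \<eta> (Suc k) = \<eta> k" for k
  proof -
    have "real N + 3 \<noteq> 0" by linarith
    then show ?thesis by (simp add: \<eta>_def)
  qed
  have \<eta>_mono: "\<eta> j \<le> \<eta> i" if "i \<le> j" for i j
    unfolding \<eta>_def using r that by (intro divide_left_mono power_increasing mult_pos_pos) auto
  have R_Suc: "R (Suc k) + (real N + 2) * \<eta> (Suc k) = R k" for k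
    using \<eta>_Suc[of k] by (simp add: R_def algebra_simps)
  have R_le: "R k \<le> r" for k
    using \<eta>_mono[of 0 k] by (simp add: R_def \<eta>_def)
  have C: "0 \<le> C"
    unfolding C_def using L by (intro divide_nonneg_nonneg mult_nonneg_nonneg) auto
  have [measurable]: "strip h p a c \<in> sets borel" for a c
    unfolding strip_def by auto
  have [measurable]: "D k \<in> sets (borel \<Otimes>\<^sub>M borel)" for k
  proof -
    have "D k = {z \<in> space (borel \<Otimes>\<^sub>M borel). fst z \<in> U \<and> snd z \<in> U \<and>
        \<eta> k \<le> norm (fst z - snd z) \<and> norm (fst z - snd z) < (real N + 2) * \<eta> k}"
      by (auto simp: space_pair_measure D_def)
    also have "\<dots> \<in> sets (borel \<Otimes>\<^sub>M borel)"
      by measurable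
    finally show ?thesis .
  qed
  have step: "m (Suc k) \<le> ennreal (1 / real N) * m k + ennreal (C * \<eta> (Suc k) powr s) * \<epsilon> (Suc k)" for k
    unfolding m_def \<epsilon>_def D_def C_def R_Suc[of k, symmetric] \<eta>_Suc[of k, symmetric]
  proof (rule Hardy_one_scale[OF w h lip shift e L s(1) \<eta>_pos N(1) _ Ub])
    fix x
    assume "x \<in> ball p (R (Suc k) + (real N + 2) * \<eta> (Suc k))" "0 < h x"
    then show "x \<in> U"
      using R_le[of k] unfolding R_Suc by (intro U) auto
  qed
  have b_step: "b (Suc k) \<le> ennreal (1 / 2) * b k + ennreal C * \<epsilon> (Suc k)" for k
  proof -
    have \<eta>k: "\<eta> (Suc k) powr - s = (real N + 3) powr s * \<eta> k powr - s"
      unfolding \<eta>_Suc[of k, symmetric] using \<eta>_pos[of "Suc k"] by (simp add: powr_mult powr_minus)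
    have "b (Suc k) \<le> ennreal (\<eta> (Suc k) powr - s) * (ennreal (1 / real N) * m k + ennreal (C * \<eta> (Suc k) powr s) * \<epsilon> (Suc k))"
      unfolding b_def by (intro mult_left_mono step) simp
    also have "\<dots> = ennreal (\<eta> (Suc k) powr - s * (1 / real N)) * m k + ennreal (\<eta> (Suc k) powr - s * (C * \<eta> (Suc k) powr s)) * \<epsilon> (Suc k)"
    proof -
      have "ennreal (\<eta> (Suc k) powr - s * (1 / real N)) = ennreal (\<eta> (Suc k) powr - s) * ennreal (1 / real N)"
        "ennreal (\<eta> (Suc k) powr - s * (C * \<eta> (Suc k) powr s)) = ennreal (\<eta> (Suc k) powr - s) * ennreal (C * \<eta> (Suc k) powr s)"
        using C by (auto intro!: ennreal_mult simp del: times_divide_eq_right)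
      then show ?thesis
        by (simp only: distrib_left mult.assoc)
    qed
    also have "\<eta> (Suc k) powr - s * (C * \<eta> (Suc k) powr s) = C"
      using \<eta>_pos[of "Suc k"] by (simp add: powr_minus)
    also have "\<eta> (Suc k) powr - s * (1 / real N) = (real N + 3) powr s / real N * \<eta> k powr - s"
      unfolding \<eta>k by simp
    also have "ennreal ((real N + 3) powr s / real N * \<eta> k powr - s) * m k + ennreal C * \<epsilon> (Suc k)
        \<le> ennreal (1 / 2 * \<eta> k powr - s) * m k + ennreal C * \<epsilon> (Suc k)"
      using N(2) by (intro add_right_mono mult_right_mono ennreal_leI) auto
    also have "ennreal (1 / 2 * \<eta> k powr - s) = ennreal (1 / 2) * ennreal (\<eta> k powr - s)"
      by (rule ennreal_mult) auto
    finally show ?thesis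
      by (simp only: b_def mult.assoc)
  qed
  have "disjoint_family_on (\<lambda>k. D (Suc k)) K" for K
  proof -
    have "D (Suc i) \<inter> D (Suc j) = {}" if "i < j" for i j
    proof -
      have "(real N + 2) * \<eta> (Suc j) \<le> \<eta> j"
        using \<eta>_Suc[of j] \<eta>_pos[of "Suc j"] by (simp add: algebra_simps)
      also have "\<dots> \<le> \<eta> (Suc i)"
        using that by (intro \<eta>_mono) auto
      finally show ?thesis
        by (auto simp: D_def)
    qed
    then show ?thesis
      unfolding disjoint_family_on_def by (metis Int_commute linorder_neqE_nat)
  qed
  note disj = this
  have sum_\<epsilon>: "(\<Sum>k<K. \<epsilon> (Suc k)) \<le> E" for K
  proof -
    have "(\<Sum>k<K. \<epsilon> (Suc k)) = (\<integral>\<^sup>+z. (\<Sum>k<K. ennreal (gagliardo s w z) * indicator (D (Suc k)) z) \<partial>(lborel \<Otimes>\<^sub>M lborel))"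
      unfolding \<epsilon>_def by (rule nn_integral_sum[symmetric]) measurable
    also have "\<dots> \<le> E"
      unfolding E_def
    proof (rule nn_integral_mono)
      fix z :: "'a \<times> 'a"
      have "(\<Sum>k<K. indicator (D (Suc k)) z) = (indicator (\<Union>k<K. D (Suc k)) z :: ennreal)"
        by (rule indicator_UN_disjoint[symmetric]) (auto intro: disj)
      also have "\<dots> \<le> indicator (U \<times> U) z"
        by (auto simp: indicator_def D_def)
      finally show "(\<Sum>k<K. ennreal (gagliardo s w z) * indicator (D (Suc k)) z) \<le> ennreal (gagliardo s w z) * indicator (U \<times> U) z"
        unfolding sum_distrib_left[symmetric] by (intro mult_left_mono) auto
    qed
    finally show ?thesis .
  qed
  have sum_b: "(\<Sum>k<K. b k) \<le> 2 * (b 0 + ennreal C * E)" for K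
  proof (induction K)
    case (Suc K)
    have half: "ennreal (1 / 2) * (2 * t) = t" for t
    proof -
      have "ennreal (1 / 2) * ennreal 2 = 1"
        by (subst ennreal_mult[symmetric]) auto
      then show ?thesis
        by (simp only: mult.assoc[symmetric] ennreal_numeral mult_1)
    qed
    have "(\<Sum>k<Suc K. b k) = b 0 + (\<Sum>k<K. b (Suc k))"
      by (rule sum.lessThan_Suc_shift)
    also have "\<dots> \<le> b 0 + (\<Sum>k<K. ennreal (1 / 2) * b k + ennreal C * \<epsilon> (Suc k))"
      by (intro add_left_mono sum_mono b_step)
    also have "\<dots> = b 0 + (ennreal (1 / 2) * (\<Sum>k<K. b k) + ennreal C * (\<Sum>k<K. \<epsilon> (Suc k)))"
      by (simp only: sum.distrib sum_distrib_left)
    also have "\<dots> \<le> b 0 + (ennreal (1 / 2) * (2 * (b 0 + ennreal C * E)) + ennreal C * E)"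
      by (intro add_left_mono add_mono mult_left_mono Suc.IH sum_\<epsilon>) auto
    also have "\<dots> = 2 * (b 0 + ennreal C * E)"
      unfolding half by (simp add: mult_2 add_ac)
    finally show ?case .
  qed simp
  have m0: "m k < \<infinity>" for k
  proof -
    have "m k \<le> (\<integral>\<^sup>+x. ennreal \<bar>w x\<bar> * indicator U x \<partial>lborel)"
      unfolding m_def using R_le[of k]
      by (intro nn_integral_mono) (auto simp: indicator_def strip_def intro!: U)
    then show ?thesis
      using w1 by (rule le_less_trans)
  qed
  have tail: "(\<Sum>k. b k) < \<infinity>"
  proof -
    have "(\<Sum>k. b k) \<le> 2 * (b 0 + ennreal C * E)"
      by (rule suminf_le_const[OF summableI sum_b])
    also have "\<dots> < \<infinity>"
      using m0[of 0] w2 by (simp add: b_def E_def ennreal_mult_less_top ennreal_add_eq_top less_top)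
    finally show ?thesis .
  qed
  let ?q = "(real N + 3) powr s"
  have "(\<integral>\<^sup>+x. ennreal \<bar>w x\<bar> * (ennreal (h x powr - s) * indicator {x \<in> ball p (r / 2). 0 < h x} x) \<partial>lborel)
    \<le> (\<integral>\<^sup>+x. ennreal ((r / 2) powr - s) * (ennreal \<bar>w x\<bar> * indicator U x)
        + (\<Sum>k. ennreal (\<eta> (Suc k) powr - s) * (ennreal \<bar>w x\<bar> * indicator (strip h p (R k) (\<eta> k)) x)) \<partial>lborel)"
    (is "_ \<le> (\<integral>\<^sup>+x. ?A x + (\<Sum>k. ?T k x) \<partial>lborel)")
  proof (rule nn_integral_mono)
    fix x
    show "ennreal \<bar>w x\<bar> * (ennreal (h x powr - s) * indicator {x \<in> ball p (r / 2). 0 < h x} x) \<le> ?A x + (\<Sum>k. ?T k x)"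
    proof (cases "x \<in> ball p (r / 2) \<and> 0 < h x")
      case True
      then have hx: "0 < h x" and bx: "dist p x < r / 2" by auto
      have "x \<in> U"
        using True r by (intro U) auto
      show ?thesis
      proof (cases "h x \<le> r / 2")
        case False
        then have "h x powr - s \<le> (r / 2) powr - s"
          using r s by (intro powr_mono2') auto
        then have "ennreal \<bar>w x\<bar> * ennreal (h x powr - s) \<le> ?A x"
          using \<open>x \<in> U\<close> by (simp add: mult.commute[of "ennreal \<bar>w x\<bar>"] mult_right_mono ennreal_leI)
        also have "\<dots> \<le> ?A x + (\<Sum>k. ?T k x)"
          by simp
        finally show ?thesis
          using True by simp
      next
        case small: True
        have "0 < 2 * h x / r" using hx r by simp
        then obtain j where "(1 / (real N + 3)) ^ j < 2 * h x / r"
          using real_arch_pow_inv[of "2 * h x / r" "1 / (real N + 3)"] by auto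
        then have "\<eta> j < h x"
          using r by (simp add: \<eta>_def power_one_over field_simps)
        then have ex: "\<eta> (Suc j) < h x"
          using \<eta>_mono[of j "Suc j"] by simp
        \<comment> \<open>The scale with \<open>\<eta> (Suc k) < h x \<le> \<eta> k\<close>.\<close>
        define k where "k = (LEAST k. \<eta> (Suc k) < h x)"
        have k: "\<eta> (Suc k) < h x"
          unfolding k_def by (rule LeastI[of _ j]) (rule ex)
        have k': "h x \<le> \<eta> k"
        proof (cases k)
          case 0
          then show ?thesis using small by (simp add: \<eta>_def)
        next
          case (Suc i)
          then have "\<not> \<eta> (Suc i) < h x"
            using not_less_Least[of i "\<lambda>k. \<eta> (Suc k) < h x"] unfolding k_def by auto
          with Suc show ?thesis by auto
        qed
        have "h x powr - s \<le> \<eta> (Suc k) powr - s"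
          using k \<eta>_pos[of "Suc k"] s by (intro powr_mono2') auto
        moreover have "x \<in> strip h p (R k) (\<eta> k)"
          using k' hx bx \<eta>_pos[of k] by (simp add: strip_def R_def)
        ultimately have "ennreal \<bar>w x\<bar> * ennreal (h x powr - s) \<le> ?T k x"
          by (simp add: mult.commute[of "ennreal \<bar>w x\<bar>"] mult_right_mono ennreal_leI)
        also have "\<dots> = (\<Sum>k\<in>{k}. ?T k x)"
          by (subst sum.insert) auto
        also have "\<dots> \<le> (\<Sum>k. ?T k x)"
          by (rule sum_le_suminf) auto
        also have "\<dots> \<le> ?A x + (\<Sum>k. ?T k x)"
          by simp
        finally show ?thesis
          using True by simp
      qed
    qed auto
  qed
  also have "\<dots> = ennreal ((r / 2) powr - s) * (\<integral>\<^sup>+x. ennreal \<bar>w x\<bar> * indicator U x \<partial>lborel)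
      + (\<Sum>k. ennreal (\<eta> (Suc k) powr - s) * m k)"
    unfolding m_def by (simp add: nn_integral_add nn_integral_suminf nn_integral_cmult)
  also have "(\<Sum>k. ennreal (\<eta> (Suc k) powr - s) * m k) = ennreal ?q * (\<Sum>k. b k)"
  proof -
    have "\<eta> (Suc k) powr - s = ?q * \<eta> k powr - s" for k
      unfolding \<eta>_Suc[of k, symmetric] using \<eta>_pos[of "Suc k"] by (simp add: powr_mult powr_minus)
    then show ?thesis
      by (simp add: b_def ennreal_mult mult.assoc)
  qed
  also have "ennreal ((r / 2) powr - s) * (\<integral>\<^sup>+x. ennreal \<bar>w x\<bar> * indicator U x \<partial>lborel) + ennreal ?q * (\<Sum>k. b k) < \<infinity>"
    using w1 tail by (simp add: ennreal_mult_less_top ennreal_add_eq_top less_top)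
  finally show ?thesis .
qed

text \<open>The nonlocal density with which the complement of \<open>U\<close> acts on the point \<open>x\<close>.\<close>

definition exterior_kernel :: "real \<Rightarrow> 'a::euclidean_space set \<Rightarrow> 'a \<Rightarrow> ennreal" where
  "exterior_kernel s U x = (\<integral>\<^sup>+y. ennreal (norm (x - y) powr - (real DIM('a) + s)) * indicator (- U) y \<partial>lborel)"

lemma borel_measurable_exterior_kernel [measurable]:
  fixes U :: "'a::euclidean_space set"
  assumes [measurable]: "U \<in> sets borel"
  shows "exterior_kernel s U \<in> borel_measurable borel"
proof -
  have [measurable]: "- U \<in> sets borel" by (rule borel_comp) (rule assms)
  show ?thesis
    unfolding exterior_kernel_def[abs_def] by measurable
qed

lemma exterior_kernel_le:
  assumes s: "0 < s"
  obtains C where "0 \<le> C"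
    "\<And>(U :: 'a::euclidean_space set) x d. 0 < d \<Longrightarrow> (\<And>y. y \<notin> U \<Longrightarrow> d \<le> norm (x - y)) \<Longrightarrow>
      exterior_kernel s U x \<le> ennreal (C * d powr - s)"
proof -
  obtain C where C: "0 \<le> C" "\<And>d. 0 < d \<Longrightarrow>
    (\<integral>\<^sup>+z. ennreal (norm (z::'a) powr - (real DIM('a) + s)) * indicator {z. d \<le> norm z} z \<partial>lborel)
      \<le> ennreal (C * d powr - s)"
    using nn_integral_kernel_outside_ball[OF s, where 'a='a] by blast
  have "exterior_kernel s U x \<le> ennreal (C * d powr - s)"
    if d: "0 < d" and far: "\<And>y. y \<notin> U \<Longrightarrow> d \<le> norm (x - y)" for U and x :: 'a and d
  proof -
    let ?f = "\<lambda>z :: 'a. ennreal (norm z powr - (real DIM('a) + s)) * indicator {z. d \<le> norm z} z"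
    have "exterior_kernel s U x \<le> (\<integral>\<^sup>+y. ?f (y + - x) \<partial>lborel)"
      unfolding exterior_kernel_def
      by (intro nn_integral_mono) (auto simp: indicator_def norm_minus_commute dest: far)
    also have "\<dots> = (\<integral>\<^sup>+y. ?f y \<partial>lborel)"
      by (rule nn_integral_translate) measurable
    also have "\<dots> \<le> ennreal (C * d powr - s)"
      by (rule C(2)[OF d])
    finally show ?thesis .
  qed
  with C(1) show thesis
    by (rule that)
qed

text \<open>The height over the graph is Lipschitz on the whole space and grows at unit speed in the
  direction \<open>e\<close>. This lets translations along \<open>e\<close> take the place of integration along \<open>e\<close> in
  graph coordinates.\<close>

lemma boundary_chart:
  fixes U :: "'a::euclidean_space set"
  assumes "lipschitz_boundary U" "p \<in> frontier U"
  obtains r e L and h :: "'a \<Rightarrow> real" where "0 < r" "norm e = 1" "1 \<le> L"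
    "\<And>x y. \<bar>h x - h y\<bar> \<le> L * norm (x - y)" "\<And>x t. h (x + t *\<^sub>R e) = h x + t"
    "\<And>x. x \<in> ball p r \<Longrightarrow> x \<in> U \<longleftrightarrow> 0 < h x"
proof -
  obtain r e L and \<gamma> :: "'a \<Rightarrow> real" where r: "0 < r" and e: "norm e = 1"
    and \<gamma>: "L-lipschitz_on {y. y \<bullet> e = 0} \<gamma>"
    and U: "U \<inter> ball p r = {x \<in> ball p r. x \<bullet> e > \<gamma> (x - (x \<bullet> e) *\<^sub>R e)}"
    using assms unfolding lipschitz_boundary_def by blast
  define P where "P x = x - (x \<bullet> e) *\<^sub>R e" for x :: 'a
  define h where "h x = x \<bullet> e - \<gamma> (P x)" for x
  have ee: "e \<bullet> e = 1"
    using e by (simp add: norm_eq_1)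
  have "0 \<le> L"
    using \<gamma> by (rule lipschitz_on_nonneg)
  have proj: "norm (z - (z \<bullet> e) *\<^sub>R e) \<le> norm z" for z
  proof (rule power2_le_imp_le)
    have "(norm (z - (z \<bullet> e) *\<^sub>R e))\<^sup>2 = (norm z)\<^sup>2 - (z \<bullet> e)\<^sup>2"
      unfolding power2_norm_eq_inner
      by (simp add: inner_diff_left inner_diff_right ee power2_eq_square inner_commute)
    then show "(norm (z - (z \<bullet> e) *\<^sub>R e))\<^sup>2 \<le> (norm z)\<^sup>2"
      by simp
  qed simp
  have P: "norm (P x - P y) \<le> norm (x - y)" for x y
    using proj[of "x - y"] by (simp add: P_def inner_diff_left algebra_simps)
  have "\<bar>h x - h y\<bar> \<le> (1 + L) * norm (x - y)" for x y
  proof -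
    have "\<bar>h x - h y\<bar> \<le> \<bar>(x - y) \<bullet> e\<bar> + \<bar>\<gamma> (P x) - \<gamma> (P y)\<bar>"
      unfolding h_def by (simp add: inner_diff_left)
    also have "\<bar>(x - y) \<bullet> e\<bar> \<le> norm (x - y)"
      using Cauchy_Schwarz_ineq2[of "x - y" e] e by simp
    also have "\<bar>\<gamma> (P x) - \<gamma> (P y)\<bar> \<le> L * norm (P x - P y)"
      using lipschitz_onD[OF \<gamma>, of "P x" "P y"] ee
      by (simp add: P_def inner_diff_left dist_norm)
    also have "\<dots> \<le> L * norm (x - y)"
      using P \<open>0 \<le> L\<close> by (rule mult_left_mono)
    finally show ?thesis
      by (simp add: algebra_simps)
  qed
  moreover have "h (x + t *\<^sub>R e) = h x + t" for x t
    by (simp add: h_def P_def inner_add_left ee algebra_simps)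
  moreover have "x \<in> U \<longleftrightarrow> 0 < h x" if "x \<in> ball p r" for x
  proof -
    have "x \<in> U \<inter> ball p r \<longleftrightarrow> x \<in> {x \<in> ball p r. x \<bullet> e > \<gamma> (x - (x \<bullet> e) *\<^sub>R e)}"
      by (simp only: U)
    with that show ?thesis
      by (simp add: h_def P_def)
  qed
  ultimately show thesis
    using r e \<open>0 \<le> L\<close> by (intro that[of r e "1 + L" h]) auto
qed

text \<open>Near an interior point the exterior kernel is bounded. Near a boundary point the distance
  to the complement is at least \<open>h x / L\<close>, so the kernel is controlled by \<open>h x powr - s\<close>.\<close>

lemma Hardy_near_point:
  fixes w :: "'a::euclidean_space \<Rightarrow> real"
  assumes w [measurable]: "w \<in> borel_measurable borel" and s: "0 < s" "s < 1"
    and U: "open U" "lipschitz_boundary U"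
    and w1: "(\<integral>\<^sup>+x. ennreal \<bar>w x\<bar> * indicator U x \<partial>lborel) < \<infinity>"
    and w2: "(\<integral>\<^sup>+z. ennreal (gagliardo s w z) * indicator (U \<times> U) z \<partial>(lborel \<Otimes>\<^sub>M lborel)) < \<infinity>"
    and p: "p \<in> closure U"
  shows "\<exists>\<rho>>0. (\<integral>\<^sup>+x. ennreal \<bar>w x\<bar> * (exterior_kernel s U x * indicator (U \<inter> ball p \<rho>) x) \<partial>lborel) < \<infinity>"
proof -
  have [measurable]: "U \<in> sets borel"
    using U(1) by simp
  obtain C where C: "0 \<le> C"
    "\<And>(U :: 'a set) x d. 0 < d \<Longrightarrow> (\<And>y. y \<notin> U \<Longrightarrow> d \<le> norm (x - y)) \<Longrightarrow>
      exterior_kernel s U x \<le> ennreal (C * d powr - s)"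
    using exterior_kernel_le[OF s(1), where 'a='a] by blast
  show ?thesis
  proof (cases "p \<in> U")
    case True
    then obtain \<rho> where \<rho>: "0 < \<rho>" "ball p \<rho> \<subseteq> U"
      using U(1) openE by blast
    have "exterior_kernel s U x \<le> ennreal (C * (\<rho> / 2) powr - s)" if "x \<in> ball p (\<rho> / 2)" for x
    proof (rule C(2))
      fix y assume "y \<notin> U"
      then have "\<rho> \<le> dist p y"
        using \<rho>(2) by (meson mem_ball not_le subsetD)
      then show "\<rho> / 2 \<le> norm (x - y)"
        using that dist_triangle[of p y x] by (simp add: dist_norm)
    qed (use \<rho> in simp)
    then have "(\<integral>\<^sup>+x. ennreal \<bar>w x\<bar> * (exterior_kernel s U x * indicator (U \<inter> ball p (\<rho> / 2)) x) \<partial>lborel)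
      \<le> (\<integral>\<^sup>+x. ennreal (C * (\<rho> / 2) powr - s) * (ennreal \<bar>w x\<bar> * indicator U x) \<partial>lborel)"
      by (intro nn_integral_mono) (auto simp: indicator_def mult.commute[of _ "ennreal \<bar>w _\<bar>"] intro!: mult_left_mono)
    also have "\<dots> = ennreal (C * (\<rho> / 2) powr - s) * (\<integral>\<^sup>+x. ennreal \<bar>w x\<bar> * indicator U x \<partial>lborel)"
      by (rule nn_integral_cmult) measurable
    also have "\<dots> < \<infinity>"
      using w1 by (simp add: ennreal_mult_less_top)
    finally show ?thesis
      using \<rho>(1) by (intro exI[of _ "\<rho> / 2"]) auto
  next
    case False
    then have "p \<in> frontier U"
      using p U(1) by (simp add: frontier_def interior_open)
    then obtain r e L and h :: "'a \<Rightarrow> real" where r: "0 < r" and e: "norm e = 1" and L: "1 \<le> L"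
      and lip: "\<And>x y. \<bar>h x - h y\<bar> \<le> L * norm (x - y)" and shift: "\<And>x t. h (x + t *\<^sub>R e) = h x + t"
      and chart: "\<And>x. x \<in> ball p r \<Longrightarrow> x \<in> U \<longleftrightarrow> 0 < h x"
      using boundary_chart[OF U(2)] by metis
    have "L-lipschitz_on UNIV h"
      using lip L by (intro lipschitz_onI) (auto simp: dist_norm)
    then have "continuous_on UNIV h"
      by (rule lipschitz_on_continuous_on)
    then have h [measurable]: "h \<in> borel_measurable borel"
      by (rule borel_measurable_continuous_onI)
    define V where "V = {x \<in> ball p (r / 2). 0 < h x}"
    have "V = ball p (r / 2) \<inter> {x \<in> space borel. 0 < h x}"
      by (auto simp: V_def)
    also have "\<dots> \<in> sets borel"
      by (intro sets.Int) (simp, measurable)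
    finally have [measurable]: "V \<in> sets borel" .
    have "h p \<le> 0"
      using chart[of p] False r by simp
    have kernel: "exterior_kernel s U x \<le> ennreal (C * (h x / L) powr - s)" if x: "x \<in> U \<inter> ball p (r / 2)" for x
    proof (rule C(2))
      have hx: "0 < h x"
        using chart[of x] x r by auto
      then show "0 < h x / L"
        using L by simp
      fix y assume y: "y \<notin> U"
      show "h x / L \<le> norm (x - y)"
      proof (cases "y \<in> ball p r")
        case True
        then have "h y \<le> 0"
          using chart[of y] y by simp
        then have "h x \<le> L * norm (x - y)"
          using lip[of x y] by simp
        then show ?thesis
          using L by (simp add: pos_divide_le_eq mult.commute)
      next
        case False
        \<comment> \<open>Outside the chart: \<open>x\<close> is closer to \<open>p\<close> than to \<open>y\<close>, and \<open>h p \<le> 0\<close>.\<close>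
        have "h x \<le> L * norm (x - p)"
          using lip[of x p] \<open>h p \<le> 0\<close> by simp
        then have "h x / L \<le> norm (x - p)"
          using L by (simp add: pos_divide_le_eq mult.commute)
        also have "\<dots> \<le> norm (x - y)"
          using x False dist_triangle[of p y x] by (simp add: dist_norm norm_minus_commute)
        finally show ?thesis .
      qed
    qed
    have "(\<integral>\<^sup>+x. ennreal \<bar>w x\<bar> * (exterior_kernel s U x * indicator (U \<inter> ball p (r / 2)) x) \<partial>lborel)
      \<le> (\<integral>\<^sup>+x. ennreal (C * L powr s) * (ennreal \<bar>w x\<bar> * (ennreal (h x powr - s) * indicator V x)) \<partial>lborel)"
    proof (rule nn_integral_mono)
      fix x
      show "ennreal \<bar>w x\<bar> * (exterior_kernel s U x * indicator (U \<inter> ball p (r / 2)) x)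
        \<le> ennreal (C * L powr s) * (ennreal \<bar>w x\<bar> * (ennreal (h x powr - s) * indicator V x))"
      proof (cases "x \<in> U \<inter> ball p (r / 2)")
        case True
        then have hx: "0 < h x" "x \<in> ball p (r / 2)"
          using chart[of x] r by auto
        have "exterior_kernel s U x \<le> ennreal (C * L powr s) * ennreal (h x powr - s)"
          using kernel[OF True] hx L C(1) by (simp add: powr_divide powr_minus field_simps flip: ennreal_mult)
        then have "ennreal \<bar>w x\<bar> * exterior_kernel s U x \<le> ennreal \<bar>w x\<bar> * (ennreal (C * L powr s) * ennreal (h x powr - s))"
          by (rule mult_left_mono) simp
        then show ?thesis
          using True hx by (simp add: V_def mult_ac)
      qed simp
    qed
    also have "\<dots> = ennreal (C * L powr s) * (\<integral>\<^sup>+x. ennreal \<bar>w x\<bar> * (ennreal (h x powr - s) * indicator V x) \<partial>lborel)"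
      by (rule nn_integral_cmult) measurable
    also have "\<dots> < \<infinity>"
      using Hardy_chart[OF w h lip shift e L s r _ _ w1 w2, of p] chart
      by (simp add: V_def ennreal_mult_less_top)
    finally show ?thesis
      using r by (intro exI[of _ "r / 2"]) auto
  qed
qed

text \<open>Fractional Hardy inequality with exponent \<open>p = 1\<close>, in qualitative form; compactness of the closure
  patches the local estimates together.\<close>

lemma Hardy_Lipschitz_domain:
  fixes w :: "'a::euclidean_space \<Rightarrow> real"
  assumes w [measurable]: "w \<in> borel_measurable borel" and s: "0 < s" "s < 1"
    and U: "bounded U" "open U" "lipschitz_boundary U"
    and w1: "(\<integral>\<^sup>+x. ennreal \<bar>w x\<bar> * indicator U x \<partial>lborel) < \<infinity>"
    and w2: "(\<integral>\<^sup>+z. ennreal (gagliardo s w z) * indicator (U \<times> U) z \<partial>(lborel \<Otimes>\<^sub>M lborel)) < \<infinity>"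
  shows "(\<integral>\<^sup>+x. ennreal \<bar>w x\<bar> * (exterior_kernel s U x * indicator U x) \<partial>lborel) < \<infinity>"
proof -
  have [measurable]: "U \<in> sets borel"
    using U(2) by simp
  let ?f = "\<lambda>B x. ennreal \<bar>w x\<bar> * (exterior_kernel s U x * indicator (U \<inter> B) x)"
  obtain \<rho> where \<rho>: "\<And>p. p \<in> closure U \<Longrightarrow> 0 < \<rho> p"
    "\<And>p. p \<in> closure U \<Longrightarrow> (\<integral>\<^sup>+x. ?f (ball p (\<rho> p)) x \<partial>lborel) < \<infinity>"
    using Hardy_near_point[OF w s U(2,3) w1 w2] by metis
  have compact: "compact (closure U)"
    using U(1) by (simp only: compact_closure)
  have cover: "closure U \<subseteq> (\<Union>p\<in>closure U. ball p (\<rho> p))"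
    using \<rho>(1) by force
  obtain T where T: "T \<subseteq> closure U" "finite T" "closure U \<subseteq> (\<Union>p\<in>T. ball p (\<rho> p))"
    by (rule compactE_image[OF compact _ cover]) (simp, blast)
  have "(\<integral>\<^sup>+x. ennreal \<bar>w x\<bar> * (exterior_kernel s U x * indicator U x) \<partial>lborel)
    \<le> (\<integral>\<^sup>+x. (\<Sum>p\<in>T. ?f (ball p (\<rho> p)) x) \<partial>lborel)"
  proof (rule nn_integral_mono)
    fix x
    show "ennreal \<bar>w x\<bar> * (exterior_kernel s U x * indicator U x) \<le> (\<Sum>p\<in>T. ?f (ball p (\<rho> p)) x)"
    proof (cases "x \<in> U")
      case True
      then obtain p where p: "p \<in> T" "x \<in> ball p (\<rho> p)"
        using T(3) closure_subset by blast
      have "ennreal \<bar>w x\<bar> * (exterior_kernel s U x * indicator U x) = ?f (ball p (\<rho> p)) x"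
        using True p by simp
      also have "\<dots> \<le> (\<Sum>p\<in>T. ?f (ball p (\<rho> p)) x)"
        using p T(2) by (intro member_le_sum) auto
      finally show ?thesis .
    qed simp
  qed
  also have "\<dots> = (\<Sum>p\<in>T. (\<integral>\<^sup>+x. ?f (ball p (\<rho> p)) x \<partial>lborel))"
    by (rule nn_integral_sum) (intro borel_measurable_times_ennreal borel_measurable_indicator; simp)
  also have "\<dots> < \<infinity>"
    using \<rho>(2) T by (simp add: ennreal_sum_less_top subset_iff)
  finally show ?thesis .
qed

text \<open>Extension by zero stays in the fractional Sobolev space. The new interaction, between \<open>U\<close> and its
  complement, is twice the Hardy integral.\<close>

lemma nn_integral_gagliardo_zero_extension:
  fixes w :: "'a::euclidean_space \<Rightarrow> real"
  assumes w [measurable]: "w \<in> borel_measurable borel" and s: "0 < s" "s < 1"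
    and U: "bounded U" "open U" "lipschitz_boundary U"
    and zero: "\<And>x. x \<notin> U \<Longrightarrow> w x = 0"
    and w1: "(\<integral>\<^sup>+x. ennreal \<bar>w x\<bar> * indicator U x \<partial>lborel) < \<infinity>"
    and w2: "(\<integral>\<^sup>+z. ennreal (gagliardo s w z) * indicator (U \<times> U) z \<partial>(lborel \<Otimes>\<^sub>M lborel)) < \<infinity>"
  shows "(\<integral>\<^sup>+z. ennreal (gagliardo s w z) \<partial>(lborel \<Otimes>\<^sub>M lborel)) < \<infinity>"
proof -
  have [measurable]: "U \<in> sets borel" "- U \<in> sets borel"
    using U(2) by auto
  let ?k = "\<lambda>x y :: 'a. norm (x - y) powr - (real DIM('a) + s)"
  let ?g = "\<lambda>x y. ennreal \<bar>w x\<bar> * indicator U x * (ennreal (?k x y) * indicator (- U) y)"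
  define g where "g z = (case z of (x, y) \<Rightarrow> ?g x y)" for z
  define g' where "g' z = (case z of (x, y) \<Rightarrow> ?g y x)" for z
  have [measurable]: "g \<in> borel_measurable (lborel \<Otimes>\<^sub>M lborel)"
    unfolding g_def[abs_def] by measurable
  have [measurable]: "g' \<in> borel_measurable (lborel \<Otimes>\<^sub>M lborel)"
    unfolding g'_def[abs_def] by measurable
  have gagliardo_eq: "gagliardo s w (x, y) = \<bar>w x - w y\<bar> * ?k x y" for x y
    by (simp only: gagliardo_def powr_minus divide_inverse prod.case)
  have le: "ennreal (gagliardo s w (x, y)) \<le>
    ennreal (gagliardo s w (x, y)) * indicator (U \<times> U) (x, y) + (?g x y + ?g y x)" for x y
    using zero[of x] zero[of y]
    by (cases "x \<in> U"; cases "y \<in> U")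
       (auto simp: gagliardo_eq norm_minus_commute[of y x] ennreal_mult)
  have hardy: "(\<integral>\<^sup>+x. (\<integral>\<^sup>+y. ?g x y \<partial>lborel) \<partial>lborel) < \<infinity>"
  proof -
    have "(\<integral>\<^sup>+y. ?g x y \<partial>lborel) = ennreal \<bar>w x\<bar> * (exterior_kernel s U x * indicator U x)" for x
      unfolding exterior_kernel_def by (subst nn_integral_cmult) (auto simp: mult_ac)
    then show ?thesis
      using Hardy_Lipschitz_domain[OF w s U w1 w2] by simp
  qed
  have "(\<integral>\<^sup>+z. ennreal (gagliardo s w z) \<partial>(lborel \<Otimes>\<^sub>M lborel))
    \<le> (\<integral>\<^sup>+z. ennreal (gagliardo s w z) * indicator (U \<times> U) z + (g z + g' z) \<partial>(lborel \<Otimes>\<^sub>M lborel))"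
    using le by (intro nn_integral_mono) (auto simp only: g_def g'_def split: prod.split)
  also have "\<dots> = (\<integral>\<^sup>+z. ennreal (gagliardo s w z) * indicator (U \<times> U) z \<partial>(lborel \<Otimes>\<^sub>M lborel))
    + ((\<integral>\<^sup>+z. g z \<partial>(lborel \<Otimes>\<^sub>M lborel)) + (\<integral>\<^sup>+z. g' z \<partial>(lborel \<Otimes>\<^sub>M lborel)))"
    by (simp add: nn_integral_add)
  also have "(\<integral>\<^sup>+z. g z \<partial>(lborel \<Otimes>\<^sub>M lborel)) = (\<integral>\<^sup>+x. (\<integral>\<^sup>+y. ?g x y \<partial>lborel) \<partial>lborel)"
    by (subst lborel.nn_integral_fst[symmetric]) (measurable, simp only: g_def prod.case)
  also have "(\<integral>\<^sup>+z. g' z \<partial>(lborel \<Otimes>\<^sub>M lborel)) = (\<integral>\<^sup>+y. (\<integral>\<^sup>+x. ?g y x \<partial>lborel) \<partial>lborel)"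
    by (subst lborel_pair.nn_integral_snd[symmetric]) (measurable, simp only: g'_def prod.case)
  finally show ?thesis
    using w2 hardy by (simp add: ennreal_add_eq_top less_top le_less_trans)
qed

section \<open>Functions of finite Gagliardo energy\<close>

text \<open>The Lipschitz bound makes the integrand integrable near the diagonal, the bound on \<open>w\<close> makes it
  integrable at infinity, and one of the two points lies in the bounded support.\<close>

lemma nn_integral_gagliardo_Lipschitz:
  fixes w :: "'a::euclidean_space \<Rightarrow> real"
  assumes s: "0 < s" "s < 1"
    and lip: "\<And>x y. \<bar>w x - w y\<bar> \<le> M * norm (x - y)"
    and bound: "\<And>x. \<bar>w x\<bar> \<le> B"
    and supp: "\<And>x. w x \<noteq> 0 \<Longrightarrow> x \<in> ball 0 R"
  shows "(\<integral>\<^sup>+z. ennreal (gagliardo s w z) \<partial>(lborel \<Otimes>\<^sub>M lborel)) < \<infinity>"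
proof -
  define n where "n = real DIM('a)"
  define S where "S = ball (0::'a) R"
  have S_meas [measurable]: "S \<in> sets borel"
    by (simp add: S_def)
  have S_fin: "emeasure lborel S < \<infinity>"
    by (rule emeasure_bounded_finite) (simp add: S_def)
  have B: "0 \<le> B"
    using bound[of 0] by linarith
  have M: "0 \<le> M"
  proof -
    obtain b :: 'a where "b \<in> Basis" using nonempty_Basis by blast
    then show ?thesis
      using lip[of b 0] by simp
  qed
  define k where "k z = ennreal M * (ennreal (norm (z::'a) powr (1 - (n + s))) * indicator (ball 0 1 - {0}) z)
    + ennreal (2 * B) * (ennreal (norm z powr - (n + s)) * indicator {z. 1 \<le> norm z} z)" for z
  have U_meas: "ball (0::'a) 1 - {0} \<in> sets borel" "{z::'a. 1 \<le> norm z} \<in> sets borel"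
    by auto
  have near_meas: "(\<lambda>z::'a. ennreal (norm z powr (1 - (n + s))) * indicator (ball 0 1 - {0}) z) \<in> borel_measurable borel"
    by (intro borel_measurable_times_ennreal borel_measurable_indicator U_meas) measurable
  have far_meas: "(\<lambda>z::'a. ennreal (norm z powr - (n + s)) * indicator {z. 1 \<le> norm z} z) \<in> borel_measurable borel"
    by (intro borel_measurable_times_ennreal borel_measurable_indicator U_meas) measurable
  have [measurable]: "k \<in> borel_measurable borel"
    unfolding k_def[abs_def] by (intro borel_measurable_add borel_measurable_times_ennreal near_meas far_meas) auto
  have k_fin: "(\<integral>\<^sup>+z. k z \<partial>lborel) < \<infinity>"
  proof -
    have "(\<integral>\<^sup>+z. k z \<partial>lborel) = ennreal M * (\<integral>\<^sup>+z. ennreal (norm (z::'a) powr (1 - (n + s))) * indicator (ball 0 1 - {0}) z \<partial>lborel)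
      + ennreal (2 * B) * (\<integral>\<^sup>+z. ennreal (norm (z::'a) powr - (n + s)) * indicator {z. 1 \<le> norm z} z \<partial>lborel)"
      unfolding k_def using near_meas far_meas by (simp add: nn_integral_add nn_integral_cmult)
    moreover obtain C where "(\<integral>\<^sup>+z. ennreal (norm (z::'a) powr - (n + s)) * indicator {z. 1 \<le> norm z} z \<partial>lborel) \<le> ennreal C"
      using nn_integral_kernel_outside_ball[OF s(1), where 'a='a] unfolding n_def by (metis zero_less_one)
    moreover have "(\<integral>\<^sup>+z. ennreal (norm (z::'a) powr (1 - (n + s))) * indicator (ball 0 1 - {0}) z \<partial>lborel) < \<infinity>"
      unfolding n_def by (rule nn_integral_kernel_unit_ball[OF s])
    ultimately show ?thesis
      by (simp add: ennreal_mult_less_top ennreal_add_eq_top less_top le_less_trans)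
  qed
  have le_k: "ennreal (gagliardo s w (x, y)) \<le> k (x - y)" for x y
  proof (cases "norm (x - y) < 1")
    case True
    show ?thesis
    proof (cases "x = y")
      case False
      then have "gagliardo s w (x, y) \<le> M * norm (x - y) / norm (x - y) powr (n + s)"
        unfolding gagliardo_def n_def using lip[of x y] by (simp add: divide_right_mono)
      also have "\<dots> = M * norm (x - y) powr (1 - (n + s))"
        using False by (simp add: powr_diff)
      finally have "ennreal (gagliardo s w (x, y)) \<le> ennreal M * ennreal (norm (x - y) powr (1 - (n + s)))"
        using M by (simp add: ennreal_leI flip: ennreal_mult)
      also have "\<dots> \<le> k (x - y)"
        unfolding k_def using True False by simp
      finally show ?thesis .
    qed (simp add: gagliardo_def)
  next
    case False
    have "gagliardo s w (x, y) \<le> 2 * B / norm (x - y) powr (n + s)"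
      unfolding gagliardo_def n_def using bound[of x] bound[of y] by (auto intro!: divide_right_mono)
    also have "\<dots> = 2 * B * norm (x - y) powr - (n + s)"
      by (simp only: powr_minus divide_inverse)
    finally have "ennreal (gagliardo s w (x, y)) \<le> ennreal (2 * B) * ennreal (norm (x - y) powr - (n + s))"
      using B by (simp add: ennreal_leI flip: ennreal_mult)
    also have "\<dots> \<le> k (x - y)"
      unfolding k_def using False by simp
    finally show ?thesis .
  qed
  define f where "f z = (case z of (x, y) \<Rightarrow> indicator S x * k (x - y))" for z
  define f' where "f' z = (case z of (x, y) \<Rightarrow> indicator S y * k (x - y))" for z
  have [measurable]: "f \<in> borel_measurable (lborel \<Otimes>\<^sub>M lborel)"
    unfolding f_def[abs_def] by measurable
  have [measurable]: "f' \<in> borel_measurable (lborel \<Otimes>\<^sub>M lborel)"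
    unfolding f'_def[abs_def] by measurable
  have "(\<integral>\<^sup>+z. ennreal (gagliardo s w z) \<partial>(lborel \<Otimes>\<^sub>M lborel)) \<le> (\<integral>\<^sup>+z. f z + f' z \<partial>(lborel \<Otimes>\<^sub>M lborel))"
  proof (rule nn_integral_mono, clarify)
    fix x y :: 'a
    show "ennreal (gagliardo s w (x, y)) \<le> f (x, y) + f' (x, y)"
    proof (cases "x \<in> S \<or> y \<in> S")
      case True
      then have "k (x - y) \<le> f (x, y) + f' (x, y)"
        by (auto simp: f_def f'_def)
      with le_k show ?thesis
        by (rule order_trans)
    next
      case False
      then have "w x = 0" "w y = 0"
        using supp unfolding S_def by blast+
      then show ?thesis
        by (simp add: gagliardo_def)
    qed
  qed
  also have "\<dots> = (\<integral>\<^sup>+z. f z \<partial>(lborel \<Otimes>\<^sub>M lborel)) + (\<integral>\<^sup>+z. f' z \<partial>(lborel \<Otimes>\<^sub>M lborel))"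
    by (rule nn_integral_add) measurable
  also have "(\<integral>\<^sup>+z. f' z \<partial>(lborel \<Otimes>\<^sub>M lborel)) = (\<integral>\<^sup>+y. (\<integral>\<^sup>+x. indicator S y * k (x - y) \<partial>lborel) \<partial>lborel)"
    by (subst lborel_pair.nn_integral_snd[symmetric]) (measurable, simp only: f'_def prod.case)
  also have "\<dots> = (\<integral>\<^sup>+y. indicator S y * (\<integral>\<^sup>+x. k x \<partial>lborel) \<partial>lborel)"
  proof (rule nn_integral_cong)
    fix y :: 'a
    have "(\<integral>\<^sup>+x. indicator S y * k (x - y) \<partial>lborel) = indicator S y * (\<integral>\<^sup>+x. k (x + - y) \<partial>lborel)"
      by (subst nn_integral_cmult) auto
    also have "(\<integral>\<^sup>+x. k (x + - y) \<partial>lborel) = (\<integral>\<^sup>+x. k x \<partial>lborel)"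
      by (rule nn_integral_translate) measurable
    finally show "(\<integral>\<^sup>+x. indicator S y * k (x - y) \<partial>lborel) = indicator S y * (\<integral>\<^sup>+x. k x \<partial>lborel)" .
  qed
  also have "(\<integral>\<^sup>+z. f z \<partial>(lborel \<Otimes>\<^sub>M lborel)) = (\<integral>\<^sup>+x. (\<integral>\<^sup>+y. indicator S x * k (x - y) \<partial>lborel) \<partial>lborel)"
    by (subst lborel.nn_integral_fst[symmetric]) (measurable, simp only: f_def prod.case)
  also have "\<dots> = (\<integral>\<^sup>+y. indicator S y * (\<integral>\<^sup>+x. k x \<partial>lborel) \<partial>lborel)"
  proof (rule nn_integral_cong)
    fix x :: 'a
    have k_even: "k (x - y) = k (y + - x)" for y
      unfolding k_def by (auto simp: norm_minus_commute[of x y] indicator_def)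
    have "(\<integral>\<^sup>+y. indicator S x * k (x - y) \<partial>lborel) = indicator S x * (\<integral>\<^sup>+y. k (y + - x) \<partial>lborel)"
      unfolding k_even by (subst nn_integral_cmult) auto
    also have "(\<integral>\<^sup>+y. k (y + - x) \<partial>lborel) = (\<integral>\<^sup>+x. k x \<partial>lborel)"
      by (rule nn_integral_translate) measurable
    finally show "(\<integral>\<^sup>+y. indicator S x * k (x - y) \<partial>lborel) = indicator S x * (\<integral>\<^sup>+x. k x \<partial>lborel)" .
  qed
  also have "(\<integral>\<^sup>+y. indicator S y * (\<integral>\<^sup>+x. k x \<partial>lborel) \<partial>lborel) = emeasure lborel S * (\<integral>\<^sup>+x. k x \<partial>lborel)"
    by (subst nn_integral_multc) auto
  finally show ?thesis
    using S_fin k_fin by (simp add: ennreal_mult_less_top ennreal_add_eq_top less_top le_less_trans)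
qed

lemma Cc_infinity_continuous:
  assumes "w \<in> Cc_infinity U" shows "continuous_on UNIV w"
  using assms unfolding Cc_infinity_def mem_Collect_eq by (metis C_k.simps(1))

lemma Cc_infinity_support:
  assumes "w \<in> Cc_infinity U"
  obtains K where "compact K" "K \<subseteq> U" "\<And>x. x \<notin> K \<Longrightarrow> w x = 0"
proof
  show "compact (closure {x. w x \<noteq> 0})" "closure {x. w x \<noteq> 0} \<subseteq> U"
    using assms by (auto simp: Cc_infinity_def)
  show "w x = 0" if "x \<notin> closure {x. w x \<noteq> 0}" for x
    using that closure_subset[of "{x. w x \<noteq> 0}"] by blast
qed

lemma continuous_compact_support_bounded:
  fixes f :: "'a::euclidean_space \<Rightarrow> real"
  assumes "continuous_on UNIV f" "compact K" "\<And>x. x \<notin> K \<Longrightarrow> f x = 0"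
  obtains B where "\<And>x. \<bar>f x\<bar> \<le> B"
proof -
  have "bounded (f ` K)"
    using assms(1,2) by (intro compact_imp_bounded compact_continuous_image continuous_on_subset[OF assms(1)]) auto
  then obtain B where B: "\<And>x. x \<in> K \<Longrightarrow> \<bar>f x\<bar> \<le> B"
    by (auto simp: bounded_iff)
  have "\<bar>f x\<bar> \<le> max B 0" for x
    using B[of x] assms(3)[of x] by (cases "x \<in> K") auto
  then show thesis by (rule that)
qed

text \<open>The directional derivatives are continuous and vanish off the support, hence are bounded.\<close>

lemma Cc_infinity_Lipschitz:
  fixes w :: "'a::euclidean_space \<Rightarrow> real"
  assumes w: "w \<in> Cc_infinity U"
  obtains M where "\<And>x y. \<bar>w x - w y\<bar> \<le> M * norm (x - y)"
proof -
  obtain K where K: "compact K" "K \<subseteq> U" "\<And>x. x \<notin> K \<Longrightarrow> w x = 0"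
    using Cc_infinity_support[OF w] by blast
  have "C_k (Suc 0) w"
    using w by (simp only: Cc_infinity_def mem_Collect_eq)
  then have diff: "\<And>x. w differentiable (at x)"
    and cont: "\<And>d. continuous_on UNIV (\<lambda>x. frechet_derivative w (at x) d)"
    by auto
  have der: "(w has_derivative frechet_derivative w (at x)) (at x)" for x
    using diff frechet_derivative_works by blast
  have zero: "frechet_derivative w (at x) d = 0" if "x \<notin> K" for x d
  proof -
    have "open (- K)"
      using K(1) by (simp add: compact_imp_closed open_Compl)
    then have "(w has_derivative (\<lambda>_. 0)) (at x)"
      using that K(3) by (intro has_derivative_transform_within_open[OF has_derivative_const]) (auto simp: K(3))
    from has_derivative_unique[OF der this] show ?thesis
      by (rule fun_cong)
  qed
  have "\<exists>B. \<forall>x. \<bar>frechet_derivative w (at x) d\<bar> \<le> B" for d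
    using continuous_compact_support_bounded[OF cont K(1) zero] by metis
  then obtain B where B: "\<And>d x. \<bar>frechet_derivative w (at x) d\<bar> \<le> B d"
    by metis
  have "onorm (frechet_derivative w (at x)) \<le> (\<Sum>b\<in>Basis. B b)" for x
  proof -
    have "onorm (frechet_derivative w (at x)) \<le> (\<Sum>b\<in>Basis. norm (frechet_derivative w (at x) b))"
      by (rule onorm_componentwise) (rule has_derivative_bounded_linear[OF der])
    also have "\<dots> \<le> (\<Sum>b\<in>Basis. B b)"
      using B by (intro sum_mono) simp
    finally show ?thesis .
  qed
  then have "norm (w x - w y) \<le> (\<Sum>b\<in>Basis. B b) * norm (x - y)" for x y
    using der by (intro differentiable_bound[of UNIV w "\<lambda>x. frechet_derivative w (at x)"]) auto
  then show thesis
    by (intro that[of "\<Sum>b\<in>Basis. B b"]) simp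
qed

lemma borel_measurable_lebesgue_gagliardo:
  fixes w :: "'a::euclidean_space \<Rightarrow> real"
  assumes "w \<in> borel_measurable lebesgue"
  shows "gagliardo s w \<in> borel_measurable lebesgue"
proof -
  have "(\<lambda>z :: 'a \<times> 'a. norm (fst z - snd z)) \<in> borel_measurable borel"
    by (intro borel_measurable_continuous_onI continuous_intros)
  then have "(\<lambda>z :: 'a \<times> 'a. norm (fst z - snd z)) \<in> borel_measurable lebesgue"
    by (simp add: measurable_completion)
  with borel_measurable_lebesgue_fst_snd[OF assms] show ?thesis
    unfolding gagliardo_def case_prod_beta' by measurable
qed

lemma gagliardo_AE_cong:
  fixes w w' :: "'a::euclidean_space \<Rightarrow> real"
  assumes "AE x in lebesgue. w x = w' x"
  shows "AE z in lebesgue. gagliardo s w z = gagliardo s w' z"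
  using AE_lebesgue_product[OF assms assms] by eventually_elim (simp add: gagliardo_def case_prod_beta)

text \<open>Lebesgue measurable version, obtained by passing to a Borel representative that vanishes
  identically outside \<open>U\<close>.\<close>

lemma integrable_gagliardo_zero_extension:
  fixes w :: "'a::euclidean_space \<Rightarrow> real"
  assumes w: "w \<in> borel_measurable lebesgue" and s: "0 < s" "s < 1"
    and U: "bounded U" "open U" "lipschitz_boundary U"
    and zero: "AE x in lebesgue. x \<notin> U \<longrightarrow> w x = 0"
    and w1: "set_integrable lebesgue U w"
    and w2: "set_integrable lebesgue (U \<times> U) (gagliardo s w)"
  shows "integrable lebesgue (gagliardo s w)"
proof -
  obtain g where g: "g \<in> borel_measurable borel" "AE x in lebesgue. w x = g x"
    using borel_representative[OF w] .
  define v where "v x = g x * indicator U x" for x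
  have v [measurable]: "v \<in> borel_measurable borel"
    unfolding v_def[abs_def] using g(1) U(2) by (intro borel_measurable_times borel_measurable_indicator) auto
  have wv: "AE x in lebesgue. w x = v x"
    using g(2) zero by eventually_elim (auto simp: v_def indicator_def)
  have "(\<integral>\<^sup>+z. ennreal (gagliardo s v z) \<partial>(lborel \<Otimes>\<^sub>M lborel)) < \<infinity>"
  proof (rule nn_integral_gagliardo_zero_extension[OF v s U])
    show "v x = 0" if "x \<notin> U" for x
      using that by (simp add: v_def)
    have "(\<integral>\<^sup>+x. ennreal \<bar>v x\<bar> * indicator U x \<partial>lborel) = (\<integral>\<^sup>+x. ennreal \<bar>v x\<bar> * indicator U x \<partial>lebesgue)"
      by (simp only: nn_integral_completion)
    also have "\<dots> = (\<integral>\<^sup>+x. ennreal (norm (indicator U x *\<^sub>R w x)) \<partial>lebesgue)"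
      by (rule nn_integral_cong_AE) (use wv in eventually_elim, auto simp: indicator_def)
    also have "\<dots> < \<infinity>"
      using w1 by (simp add: set_integrable_def integrable_iff_bounded)
    finally show "(\<integral>\<^sup>+x. ennreal \<bar>v x\<bar> * indicator U x \<partial>lborel) < \<infinity>" .
    have "(\<integral>\<^sup>+z. ennreal (gagliardo s v z) * indicator (U \<times> U) z \<partial>(lborel \<Otimes>\<^sub>M lborel))
      = (\<integral>\<^sup>+z. ennreal (gagliardo s v z) * indicator (U \<times> U) z \<partial>lebesgue)"
      by (simp only: nn_integral_completion lborel_prod)
    also have "\<dots> = (\<integral>\<^sup>+z. ennreal (norm (indicator (U \<times> U) z *\<^sub>R gagliardo s w z)) \<partial>lebesgue)"
      by (rule nn_integral_cong_AE)
         (use gagliardo_AE_cong[OF wv, of s] in eventually_elim, auto simp: indicator_def gagliardo_nonneg)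
    also have "\<dots> < \<infinity>"
      using w2 by (simp add: set_integrable_def integrable_iff_bounded)
    finally show "(\<integral>\<^sup>+z. ennreal (gagliardo s v z) * indicator (U \<times> U) z \<partial>(lborel \<Otimes>\<^sub>M lborel)) < \<infinity>" .
  qed
  also have "(\<integral>\<^sup>+z. ennreal (gagliardo s v z) \<partial>(lborel \<Otimes>\<^sub>M lborel)) = (\<integral>\<^sup>+z. ennreal (gagliardo s v z) \<partial>lebesgue)"
    by (simp only: nn_integral_completion lborel_prod)
  also have "\<dots> = (\<integral>\<^sup>+z. ennreal (norm (gagliardo s w z)) \<partial>lebesgue)"
    by (rule nn_integral_cong_AE)
       (use gagliardo_AE_cong[OF wv, of s] in eventually_elim, auto simp: gagliardo_nonneg)
  finally show ?thesis
    using borel_measurable_lebesgue_gagliardo[OF w] by (intro integrableI_bounded)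
qed

lemma integrable_gagliardo_Cc_infinity:
  fixes w :: "'a::euclidean_space \<Rightarrow> real"
  assumes w: "w \<in> Cc_infinity U" and s: "0 < s" "s < 1"
  shows "integrable lebesgue (gagliardo s w)"
proof -
  obtain K where K: "compact K" "K \<subseteq> U" "\<And>x. x \<notin> K \<Longrightarrow> w x = 0"
    using Cc_infinity_support[OF w] by blast
  obtain M where M: "\<And>x y. \<bar>w x - w y\<bar> \<le> M * norm (x - y)"
    using Cc_infinity_Lipschitz[OF w] by blast
  obtain B where B: "\<And>x. \<bar>w x\<bar> \<le> B"
    using continuous_compact_support_bounded[OF Cc_infinity_continuous[OF w] K(1,3)] by blast
  obtain R where R: "K \<subseteq> ball 0 R"
    using bounded_subset_ballD[OF compact_imp_bounded[OF K(1)], of 0] by blast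
  have "(\<integral>\<^sup>+z. ennreal (gagliardo s w z) \<partial>(lborel \<Otimes>\<^sub>M lborel)) < \<infinity>"
    using R K(3) by (intro nn_integral_gagliardo_Lipschitz[OF s M B]) blast
  also have "(\<integral>\<^sup>+z. ennreal (gagliardo s w z) \<partial>(lborel \<Otimes>\<^sub>M lborel)) = (\<integral>\<^sup>+z. ennreal (norm (gagliardo s w z)) \<partial>lebesgue)"
    by (simp add: nn_integral_completion lborel_prod gagliardo_nonneg)
  finally show ?thesis
    using borel_measurable_continuous_onI[OF Cc_infinity_continuous[OF w]]
    by (intro integrableI_bounded borel_measurable_lebesgue_gagliardo) (simp_all add: measurable_completion)
qed

section \<open>The pairing and the energy difference\<close>

lemma gagliardo_cart:
  "gagliardo s (w :: real ^ 'n \<Rightarrow> real) = (\<lambda>(x, y). \<bar>w x - w y\<bar> / norm (x - y) powr (real CARD('n) + s))"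
  by (simp add: gagliardo_def)

lemma one_le_CARD: "1 \<le> CARD('n::finite)"
  using zero_less_card_finite[where 'a='n] by linarith

text \<open>This bound and the one for \<open>F_s_diff_integrand\<close> reduce every convergence question to the
  Gagliardo energy of the variation.\<close>

lemma abs_H_s_integrand_le:
  fixes u w :: "real ^ 'n \<Rightarrow> real"
  assumes "0 \<le> s"
  shows "\<bar>H_s_integrand s u w z\<bar> \<le> 2 * gagliardo s w z"
proof (cases z)
  case (Pair x y)
  have "\<bar>G_s CARD('n) s ((u x - u y) / norm (x - y)) * (w x - w y)\<bar> \<le> 2 * \<bar>w x - w y\<bar>"
    unfolding abs_mult by (intro mult_right_mono G_s_bounded assms one_le_CARD) simp
  from divide_right_mono[OF this, of "norm (x - y) powr (real CARD('n) + s)"] show ?thesis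
    by (simp add: Pair H_s_integrand_def gagliardo_cart abs_divide)
qed

lemma div_norm_powr:
  fixes x :: "'a::real_normed_vector"
  shows "a / norm x / norm x powr (n - 1 + s) = a / norm x powr (n + s)"
proof (cases "x = 0")
  case False
  have "norm x * norm x powr (n - 1 + s) = norm x powr (n + s)"
    by (simp add: powr_mult_base)
  then show ?thesis
    by (simp add: divide_divide_eq_left)
qed simp

lemma abs_F_s_diff_integrand_le:
  fixes u v :: "real ^ 'n \<Rightarrow> real"
  assumes "0 \<le> s"
  shows "\<bar>F_s_diff_integrand s u v z\<bar> \<le> 2 * gagliardo s (\<lambda>x. v x - u x) z"
proof (cases z)
  case (Pair x y)
  let ?N = "norm (x - y)"
  have "\<bar>cal_G_s CARD('n) s ((u x - u y) / ?N) - cal_G_s CARD('n) s ((v x - v y) / ?N)\<bar>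
      \<le> 2 * \<bar>(u x - u y) / ?N - (v x - v y) / ?N\<bar>"
    by (intro cal_G_s_lipschitz assms one_le_CARD)
  also have "(u x - u y) / ?N - (v x - v y) / ?N = - (((v x - u x) - (v y - u y)) / ?N)"
    by (simp add: diff_divide_distrib)
  finally have "\<bar>cal_G_s CARD('n) s ((u x - u y) / ?N) - cal_G_s CARD('n) s ((v x - v y) / ?N)\<bar>
      \<le> 2 * \<bar>(v x - u x) - (v y - u y)\<bar> / ?N"
    by (simp add: abs_divide)
  from divide_right_mono[OF this, of "?N powr (real CARD('n) - 1 + s)"] show ?thesis
    unfolding div_norm_powr by (simp add: Pair F_s_diff_integrand_def gagliardo_cart abs_divide)
qed

lemma F_s_diff_integrand_le_H_s:
  fixes u v :: "real ^ 'n \<Rightarrow> real"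
  shows "F_s_diff_integrand s u v z \<le> - H_s_integrand s u (\<lambda>x. v x - u x) z"
proof (cases z)
  case (Pair x y)
  let ?N = "norm (x - y)"
  let ?a = "(u x - u y) / ?N"
  have "cal_G_s CARD('n) s ?a - cal_G_s CARD('n) s ((v x - v y) / ?N) \<le> G_s CARD('n) s ?a * (?a - (v x - v y) / ?N)"
    by (rule cal_G_s_convex)
  also have "\<dots> = - (G_s CARD('n) s ?a * ((v x - u x) - (v y - u y))) / ?N"
    by (simp add: diff_divide_distrib[symmetric] algebra_simps)
  finally have "(cal_G_s CARD('n) s ?a - cal_G_s CARD('n) s ((v x - v y) / ?N)) / ?N powr (real CARD('n) - 1 + s)
      \<le> - (G_s CARD('n) s ?a * ((v x - u x) - (v y - u y))) / ?N / ?N powr (real CARD('n) - 1 + s)"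
    by (rule divide_right_mono) simp
  then show ?thesis
    unfolding div_norm_powr by (simp add: Pair F_s_diff_integrand_def H_s_integrand_def)
qed

lemma difference_quotient_measurable:
  fixes u :: "real ^ 'n \<Rightarrow> real"
  assumes "u \<in> borel_measurable lebesgue"
  shows "(\<lambda>z :: (real ^ 'n) \<times> (real ^ 'n). u (fst z) - u (snd z)) \<in> borel_measurable lebesgue"
    and "(\<lambda>z :: (real ^ 'n) \<times> (real ^ 'n). norm (fst z - snd z)) \<in> borel_measurable lebesgue"
proof -
  have "(\<lambda>z :: (real ^ 'n) \<times> (real ^ 'n). norm (fst z - snd z)) \<in> borel_measurable borel"
    by (intro borel_measurable_continuous_onI continuous_intros)
  then show "(\<lambda>z :: (real ^ 'n) \<times> (real ^ 'n). norm (fst z - snd z)) \<in> borel_measurable lebesgue"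
    by (simp add: measurable_completion)
  show "(\<lambda>z :: (real ^ 'n) \<times> (real ^ 'n). u (fst z) - u (snd z)) \<in> borel_measurable lebesgue"
    by (intro borel_measurable_diff borel_measurable_lebesgue_fst_snd assms)
qed

lemma H_s_integrand_measurable:
  fixes u w :: "real ^ 'n \<Rightarrow> real"
  assumes "u \<in> borel_measurable lebesgue" "w \<in> borel_measurable lebesgue"
  shows "H_s_integrand s u w \<in> borel_measurable lebesgue"
proof -
  note [measurable] = difference_quotient_measurable[OF assms(1)] difference_quotient_measurable(1)[OF assms(2)]
    borel_measurable_continuous_onI[OF continuous_G_s[of UNIV]]
  show ?thesis
    unfolding H_s_integrand_def case_prod_beta' by measurable
qed

lemma F_s_diff_integrand_measurable:
  fixes u v :: "real ^ 'n \<Rightarrow> real"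
  assumes "u \<in> borel_measurable lebesgue" "v \<in> borel_measurable lebesgue"
  shows "F_s_diff_integrand s u v \<in> borel_measurable lebesgue"
proof -
  note [measurable] = difference_quotient_measurable[OF assms(1)] difference_quotient_measurable(1)[OF assms(2)]
    borel_measurable_continuous_onI[OF continuous_cal_G_s[of UNIV]]
  show ?thesis
    unfolding F_s_diff_integrand_def case_prod_beta' by measurable
qed

lemma H_s_pairing_converges_of_finite_energy:
  fixes u w :: "real ^ 'n \<Rightarrow> real"
  assumes "0 \<le> s" "u \<in> borel_measurable lebesgue" "w \<in> borel_measurable lebesgue"
    and "integrable lebesgue (gagliardo s w)"
  shows "H_s_pairing_converges s u w"
  unfolding H_s_pairing_converges_def
proof (rule Bochner_Integration.integrable_bound)
  show "integrable lebesgue (\<lambda>z. 2 * gagliardo s w z)"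
    using assms(4) by simp
  show "H_s_integrand s u w \<in> borel_measurable lebesgue"
    by (intro H_s_integrand_measurable assms)
  show "AE z in lebesgue. norm (H_s_integrand s u w z) \<le> norm (2 * gagliardo s w z)"
    by (rule always_eventually, rule allI)
       (use abs_H_s_integrand_le[OF assms(1), of u w] gagliardo_nonneg[of s w] in \<open>simp add: abs_mult\<close>)
qed

lemma F_s_diff_integrand_integrable:
  fixes u v :: "real ^ 'n \<Rightarrow> real"
  assumes "0 \<le> s" "u \<in> borel_measurable lebesgue" "v \<in> borel_measurable lebesgue"
    and "integrable lebesgue (gagliardo s (\<lambda>x. v x - u x))"
  shows "integrable lebesgue (F_s_diff_integrand s u v)"
proof (rule Bochner_Integration.integrable_bound)
  show "integrable lebesgue (\<lambda>z. 2 * gagliardo s (\<lambda>x. v x - u x) z)"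
    using assms(4) by simp
  show "F_s_diff_integrand s u v \<in> borel_measurable lebesgue"
    by (intro F_s_diff_integrand_measurable assms)
  show "AE z in lebesgue. norm (F_s_diff_integrand s u v z) \<le> norm (2 * gagliardo s (\<lambda>x. v x - u x) z)"
    by (rule always_eventually, rule allI)
       (use abs_F_s_diff_integrand_le[OF assms(1), of u v] gagliardo_nonneg[of s "\<lambda>x. v x - u x"] in \<open>simp add: abs_mult\<close>)
qed

lemma Q_set_measurable:
  assumes "open (U :: (real ^ 'n) set)"
  shows "Q_set U \<in> sets lebesgue"
proof -
  have "closed ((- U) \<times> (- U))"
    using assms by (intro closed_Times) auto
  then have "open (Q_set U)"
    unfolding Q_set_def by (simp add: open_Diff)
  then show ?thesis
    by (simp add: sets_completionI_sets)
qed

lemma set_integrable_of_integrable: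
  fixes f :: "'a \<Rightarrow> real"
  assumes "integrable M f" "A \<in> sets M"
  shows "set_integrable M A f"
  using assms unfolding set_integrable_def by (rule integrable_mult_indicator[rotated])

lemma H_s_pairing_eq_integral_Q_set:
  fixes u w :: "real ^ 'n \<Rightarrow> real"
  assumes "u \<in> borel_measurable lebesgue" "w \<in> borel_measurable lebesgue"
    and "open U" and zero: "AE x in lebesgue. x \<notin> U \<longrightarrow> w x = 0"
  shows "(LINT z:Q_set U|lebesgue. H_s_integrand s u w z) = H_s_pairing s u w"
  unfolding H_s_pairing_def set_lebesgue_integral_def
proof (rule integral_cong_AE)
  show "AE z in lebesgue. indicator (Q_set U) z *\<^sub>R H_s_integrand s u w z = H_s_integrand s u w z"
    using AE_lebesgue_product[OF zero zero]
    by eventually_elim (auto simp: H_s_integrand_def Q_set_def indicator_def)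
  show "H_s_integrand s u w \<in> borel_measurable lebesgue"
    by (intro H_s_integrand_measurable assms)
  then show "(\<lambda>z. indicator (Q_set U) z *\<^sub>R H_s_integrand s u w z) \<in> borel_measurable lebesgue"
    by (intro borel_measurable_scaleR borel_measurable_indicator Q_set_measurable assms)
qed

section \<open>Convexity and the first variation\<close>

text \<open>By convexity, the energy of a competitor exceeds that of \<open>u\<close> by at least the first variation. The
  pairing may be taken over all of space, since its integrand vanishes off \<open>Q_set U\<close>.\<close>

lemma minimizes_F_s_of_pairing_nonneg:
  fixes u :: "real ^ 'n \<Rightarrow> real"
  assumes s: "0 \<le> s" and U: "open U" and uK: "u \<in> K"
    and meas: "\<And>v. v \<in> K \<Longrightarrow> v \<in> borel_measurable lebesgue"
    and energy: "\<And>v. v \<in> K \<Longrightarrow> integrable lebesgue (gagliardo s (\<lambda>x. v x - u x))"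
    and ext: "\<And>v. v \<in> K \<Longrightarrow> AE x in lebesgue. x \<notin> U \<longrightarrow> v x - u x = 0"
    and nonneg: "\<And>v. v \<in> K \<Longrightarrow> 0 \<le> H_s_pairing s u (\<lambda>x. v x - u x)"
  shows "minimizes_F_s s U K u"
  unfolding minimizes_F_s_def
proof (intro conjI ballI uK)
  fix v assume v: "v \<in> K"
  let ?w = "\<lambda>x. v x - u x"
  have w: "?w \<in> borel_measurable lebesgue"
    by (intro borel_measurable_diff meas v uK)
  show F: "set_integrable lebesgue (Q_set U) (F_s_diff_integrand s u v)"
    by (intro set_integrable_of_integrable F_s_diff_integrand_integrable s meas uK v energy Q_set_measurable U)
  have H: "set_integrable lebesgue (Q_set U) (H_s_integrand s u ?w)"
    using H_s_pairing_converges_of_finite_energy[OF s meas[OF uK] w energy[OF v]]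
    by (intro set_integrable_of_integrable Q_set_measurable U) (simp add: H_s_pairing_converges_def)
  have "(LINT z:Q_set U|lebesgue. F_s_diff_integrand s u v z) \<le> (LINT z:Q_set U|lebesgue. - H_s_integrand s u ?w z)"
    using H F by (intro set_integral_mono F_s_diff_integrand_le_H_s) (auto simp: set_integrable_def)
  also have "\<dots> = - (LINT z:Q_set U|lebesgue. H_s_integrand s u ?w z)"
    by (simp add: set_lebesgue_integral_def)
  also have "\<dots> = - H_s_pairing s u ?w"
    by (subst H_s_pairing_eq_integral_Q_set[OF meas[OF uK] w U ext[OF v]]) simp
  also have "\<dots> \<le> 0"
    using nonneg[OF v] by simp
  finally show "(LINT z:Q_set U|lebesgue. F_s_diff_integrand s u v z) \<le> 0" .
qed

lemma cal_G_s_difference_quotient: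
  "(\<lambda>m. real (Suc m) * (cal_G_s n s a - cal_G_s n s (a + b / real (Suc m)))) \<longlonglongrightarrow> - (G_s n s a * b)"
proof -
  have "((\<lambda>t. cal_G_s n s (a + t * b)) has_real_derivative G_s n s (a + 0 * b) * b) (at 0)"
    by (rule DERIV_chain2[OF cal_G_s_has_derivative]) (auto intro!: derivative_eq_intros)
  then have "((\<lambda>t. (cal_G_s n s (a + t * b) - cal_G_s n s a) / t) \<longlongrightarrow> G_s n s a * b) (at 0)"
    by (simp add: has_field_derivative_iff)
  moreover have "filterlim (\<lambda>m. inverse (real (Suc m))) (at 0) sequentially"
    unfolding filterlim_at using LIMSEQ_inverse_real_of_nat by simp
  ultimately have "(\<lambda>m. (cal_G_s n s (a + inverse (real (Suc m)) * b) - cal_G_s n s a) / inverse (real (Suc m))) \<longlonglongrightarrow> G_s n s a * b"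
    by (rule filterlim_compose)
  from tendsto_minus[OF this] show ?thesis
    by (rule Lim_transform_eventually) (auto simp: field_simps intro!: always_eventually)
qed

text \<open>The difference quotients of the energy along \<open>u + w / (m + 1)\<close> converge pointwise to the integrand of
  the pairing and are dominated by the Gagliardo integrand of \<open>w\<close>.\<close>

lemma pairing_nonneg_of_minimizes_F_s:
  fixes u w :: "real ^ 'n \<Rightarrow> real"
  assumes s: "0 \<le> s" and U: "open U" and min: "minimizes_F_s s U K u"
    and u: "u \<in> borel_measurable lebesgue" and w: "w \<in> borel_measurable lebesgue"
    and energy: "integrable lebesgue (gagliardo s w)"
    and zero: "AE x in lebesgue. x \<notin> U \<longrightarrow> w x = 0"
    and K: "\<And>t. 0 < t \<Longrightarrow> t \<le> 1 \<Longrightarrow> (\<lambda>x. u x + t * w x) \<in> K"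
  shows "0 \<le> H_s_pairing s u w"
proof -
  define v where "v m x = u x + inverse (real (Suc m)) * w x" for m x
  let ?F = "\<lambda>m z. indicator (Q_set U) z *\<^sub>R (real (Suc m) * F_s_diff_integrand s u (v m) z)"
  have vm: "v m \<in> borel_measurable lebesgue" for m
    unfolding v_def[abs_def] using u w by measurable
  have lim: "(\<lambda>m. integral\<^sup>L lebesgue (?F m)) \<longlonglongrightarrow>
    integral\<^sup>L lebesgue (\<lambda>z. indicator (Q_set U) z *\<^sub>R (- H_s_integrand s u w z))"
  proof (rule integral_dominated_convergence[where w = "\<lambda>z. 2 * gagliardo s w z"])
    show "(\<lambda>z. indicator (Q_set U) z *\<^sub>R (- H_s_integrand s u w z)) \<in> borel_measurable lebesgue"
      by (intro borel_measurable_scaleR borel_measurable_indicator borel_measurable_uminus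
        H_s_integrand_measurable Q_set_measurable U u w)
    show "?F m \<in> borel_measurable lebesgue" for m
      by (intro borel_measurable_scaleR borel_measurable_indicator borel_measurable_times borel_measurable_const
        F_s_diff_integrand_measurable Q_set_measurable U u vm)
    show "integrable lebesgue (\<lambda>z. 2 * gagliardo s w z)"
      using energy by simp
    show "AE z in lebesgue. (\<lambda>m. ?F m z) \<longlonglongrightarrow> indicator (Q_set U) z *\<^sub>R (- H_s_integrand s u w z)"
    proof (intro always_eventually allI tendsto_scaleR tendsto_const)
      fix z :: "(real ^ 'n) \<times> (real ^ 'n)"
      obtain x y where z: "z = (x, y)" by (cases z)
      let ?N = "norm (x - y)"
      let ?a = "(u x - u y) / ?N" and ?b = "(w x - w y) / ?N"
      have "(v m x - v m y) / ?N = ?a + ?b / real (Suc m)" for m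
        by (simp add: v_def diff_divide_distrib add_divide_distrib divide_inverse algebra_simps)
      then have F: "real (Suc m) * F_s_diff_integrand s u (v m) z =
          real (Suc m) * (cal_G_s CARD('n) s ?a - cal_G_s CARD('n) s (?a + ?b / real (Suc m))) / ?N powr (real CARD('n) - 1 + s)" for m
        by (simp only: z F_s_diff_integrand_def prod.case times_divide_eq_right)
      have H: "- H_s_integrand s u w z = - (G_s CARD('n) s ?a * ?b) / ?N powr (real CARD('n) - 1 + s)"
      proof -
        have "- (G_s CARD('n) s ?a * ?b) = - (G_s CARD('n) s ?a * (w x - w y)) / ?N"
          by simp
        then show ?thesis
          by (simp only: div_norm_powr) (simp add: z H_s_integrand_def)
      qed
      show "(\<lambda>m. real (Suc m) * F_s_diff_integrand s u (v m) z) \<longlonglongrightarrow> - H_s_integrand s u w z"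
        unfolding F H divide_inverse[of _ "?N powr (real CARD('n) - 1 + s)"]
        by (intro tendsto_mult_right cal_G_s_difference_quotient)
    qed
    show "AE z in lebesgue. norm (?F m z) \<le> 2 * gagliardo s w z" for m
    proof (intro always_eventually allI)
      fix z :: "(real ^ 'n) \<times> (real ^ 'n)"
      have "gagliardo s (\<lambda>x. v m x - u x) z = inverse (real (Suc m)) * gagliardo s w z"
        unfolding v_def gagliardo_def case_prod_beta
        by (simp add: right_diff_distrib[symmetric] abs_mult del: of_nat_Suc)
      with abs_F_s_diff_integrand_le[OF s, of u "v m" z]
      have "\<bar>F_s_diff_integrand s u (v m) z\<bar> \<le> 2 * (inverse (real (Suc m)) * gagliardo s w z)"
        by simp
      from mult_left_mono[OF this, of "real (Suc m)"]
      have "real (Suc m) * \<bar>F_s_diff_integrand s u (v m) z\<bar> \<le> real (Suc m) * (2 * (inverse (real (Suc m)) * gagliardo s w z))"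
        by simp
      also have "\<dots> = 2 * gagliardo s w z"
        by (simp add: field_simps)
      finally have "\<bar>real (Suc m) * F_s_diff_integrand s u (v m) z\<bar> \<le> 2 * gagliardo s w z"
        by (simp add: abs_mult del: of_nat_Suc)
      then show "norm (?F m z) \<le> 2 * gagliardo s w z"
        using gagliardo_nonneg[of s w z] by (simp add: indicator_def del: of_nat_Suc)
    qed
  qed
  have "integral\<^sup>L lebesgue (?F m) \<le> 0" for m
  proof -
    have "v m \<in> K"
      unfolding v_def[abs_def] by (rule K) (auto simp: field_simps)
    then have "(LINT z:Q_set U|lebesgue. F_s_diff_integrand s u (v m) z) \<le> 0"
      using min unfolding minimizes_F_s_def by blast
    then have "real (Suc m) * (LINT z:Q_set U|lebesgue. F_s_diff_integrand s u (v m) z) \<le> 0"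
      by (intro mult_nonneg_nonpos) auto
    moreover have "integral\<^sup>L lebesgue (?F m) = real (Suc m) * (LINT z:Q_set U|lebesgue. F_s_diff_integrand s u (v m) z)"
      unfolding set_lebesgue_integral_def integral_mult_right_zero[symmetric]
      by (intro Bochner_Integration.integral_cong) auto
    ultimately show ?thesis by simp
  qed
  then have "integral\<^sup>L lebesgue (\<lambda>z. indicator (Q_set U) z *\<^sub>R (- H_s_integrand s u w z)) \<le> 0"
    using lim by (intro LIMSEQ_le_const2[OF lim]) auto
  moreover have "integral\<^sup>L lebesgue (\<lambda>z. indicator (Q_set U) z *\<^sub>R (- H_s_integrand s u w z)) =
      - (LINT z:Q_set U|lebesgue. H_s_integrand s u w z)"
    by (simp add: set_lebesgue_integral_def)
  ultimately show ?thesis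
    using H_s_pairing_eq_integral_Q_set[OF u w U zero, of s] by simp
qed

section \<open>Variations that vanish outside a domain\<close>

text \<open>The natural space of variations: the analogue of \<open>W\<^sub>0\<^sup>s\<^sup>,\<^sup>1\<close>, with the energy taken over the whole
  space. Unlike \<open>W_s\<close> it grows with the domain, so that variations on a subdomain are also
  variations on the whole domain.\<close>

definition W_s_zero :: "real \<Rightarrow> (real ^ 'n) set \<Rightarrow> (real ^ 'n \<Rightarrow> real) set" where
  "W_s_zero s U = {w \<in> borel_measurable lebesgue. integrable lebesgue w \<and>
     integrable lebesgue (gagliardo s w) \<and> (AE x in lebesgue. x \<notin> U \<longrightarrow> w x = 0)}"

lemma W_s_iff:
  "u \<in> W_s s U \<longleftrightarrow> u \<in> borel_measurable lebesgue \<and> set_integrable lebesgue U u \<and>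
     set_integrable lebesgue (U \<times> U) (gagliardo s u)"
  by (simp add: W_s_def gagliardo_cart)

lemma open_sets_lebesgue: "open (U :: 'a::euclidean_space set) \<Longrightarrow> U \<in> sets lebesgue"
  by (simp add: sets_completionI_sets)

lemma open_Times_sets_lebesgue:
  "open (U :: 'a::euclidean_space set) \<Longrightarrow> U \<times> U \<in> sets lebesgue"
  by (intro open_sets_lebesgue open_Times)

lemma W_s_subset:
  assumes "u \<in> W_s s V" "U \<subseteq> V" "open U"
  shows "u \<in> W_s s U"
  using assms unfolding W_s_iff
  by (auto intro: set_integrable_subset open_sets_lebesgue open_Times_sets_lebesgue)

lemma W_s_zero_subset_W_s:
  assumes "w \<in> W_s_zero s U" "open V"
  shows "w \<in> W_s s V"
  using assms unfolding W_s_iff W_s_zero_def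
  by (auto intro: set_integrable_of_integrable open_sets_lebesgue open_Times_sets_lebesgue)

lemma W_s_zero_mono:
  assumes "w \<in> W_s_zero s U" "U \<subseteq> V"
  shows "w \<in> W_s_zero s V"
proof -
  have "AE x in lebesgue. x \<notin> V \<longrightarrow> w x = 0"
    using assms unfolding W_s_zero_def by (auto elim!: eventually_mono)
  then show ?thesis
    using assms by (simp add: W_s_zero_def)
qed

lemma gagliardo_add_mult_le:
  "gagliardo s (\<lambda>x. u x + t * w x) z \<le> gagliardo s u z + \<bar>t\<bar> * gagliardo s w z"
proof (cases z)
  case (Pair x y)
  have "\<bar>u x + t * w x - (u y + t * w y)\<bar> = \<bar>(u x - u y) + t * (w x - w y)\<bar>"
    by (simp add: algebra_simps)
  also have "\<dots> \<le> \<bar>u x - u y\<bar> + \<bar>t\<bar> * \<bar>w x - w y\<bar>"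
    unfolding abs_mult[symmetric] by (rule abs_triangle_ineq)
  finally show ?thesis
    unfolding Pair gagliardo_def
    by (simp add: add_divide_distrib[symmetric] divide_right_mono)
qed

lemma W_s_add_mult:
  assumes u: "u \<in> W_s s U" and w: "w \<in> W_s s U" and U: "open U"
  shows "(\<lambda>x. u x + t * w x) \<in> W_s s U"
  unfolding W_s_iff
proof (intro conjI)
  show meas: "(\<lambda>x. u x + t * w x) \<in> borel_measurable lebesgue"
    using u w unfolding W_s_iff by (intro borel_measurable_add borel_measurable_times) auto
  show "set_integrable lebesgue U (\<lambda>x. u x + t * w x)"
    using u w unfolding W_s_iff by (intro set_integral_add set_integrable_mult_right) auto
  have sum: "set_integrable lebesgue (U \<times> U) (\<lambda>z. gagliardo s u z + \<bar>t\<bar> * gagliardo s w z)"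
    using u w unfolding W_s_iff by (intro set_integral_add set_integrable_mult_right) auto
  show "set_integrable lebesgue (U \<times> U) (gagliardo s (\<lambda>x. u x + t * w x))"
    unfolding set_integrable_def
  proof (rule Bochner_Integration.integrable_bound[OF sum[unfolded set_integrable_def]])
    show "(\<lambda>z. indicator (U \<times> U) z *\<^sub>R gagliardo s (\<lambda>x. u x + t * w x) z) \<in> borel_measurable lebesgue"
      by (intro borel_measurable_scaleR borel_measurable_indicator open_Times_sets_lebesgue U
        borel_measurable_lebesgue_gagliardo meas)
    show "AE z in lebesgue. norm (indicator (U \<times> U) z *\<^sub>R gagliardo s (\<lambda>x. u x + t * w x) z)
      \<le> norm (indicator (U \<times> U) z *\<^sub>R (gagliardo s u z + \<bar>t\<bar> * gagliardo s w z))"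
    proof (intro always_eventually allI)
      fix z
      have "\<bar>gagliardo s (\<lambda>x. u x + t * w x) z\<bar> \<le> \<bar>gagliardo s u z + \<bar>t\<bar> * gagliardo s w z\<bar>"
        using gagliardo_add_mult_le[of s u t w z] gagliardo_nonneg[of s "\<lambda>x. u x + t * w x" z] by linarith
      then show "norm (indicator (U \<times> U) z *\<^sub>R gagliardo s (\<lambda>x. u x + t * w x) z)
        \<le> norm (indicator (U \<times> U) z *\<^sub>R (gagliardo s u z + \<bar>t\<bar> * gagliardo s w z))"
        by (simp add: indicator_def)
    qed
  qed
qed

text \<open>Here the Lipschitz boundary is used: finite energy inside the domain gives finite energy over the
  whole space.\<close>

lemma W_s_zero_of_W_s:
  fixes w :: "real ^ 'n \<Rightarrow> real"
  assumes s: "0 < s" "s < 1" and U: "bounded U" "open U" "lipschitz_boundary U"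
    and w: "w \<in> W_s s U" and zero: "AE x in lebesgue. x \<notin> U \<longrightarrow> w x = 0"
  shows "w \<in> W_s_zero s U"
proof -
  have meas: "w \<in> borel_measurable lebesgue"
    using w by (simp add: W_s_iff)
  have "integrable lebesgue (gagliardo s w)"
    using w by (intro integrable_gagliardo_zero_extension[OF _ s U zero]) (auto simp: W_s_iff)
  moreover have "integrable lebesgue w"
  proof -
    have "integrable lebesgue (\<lambda>x. indicator U x *\<^sub>R w x)"
      using w by (simp add: W_s_iff set_integrable_def)
    moreover have "AE x in lebesgue. indicator U x *\<^sub>R w x = w x"
      using zero by eventually_elim (auto simp: indicator_def)
    ultimately show ?thesis
      using meas by (intro integrable_cong_AE_imp[of _ "\<lambda>x. indicator U x *\<^sub>R w x" w])
  qed
  ultimately show ?thesis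
    using meas zero by (simp add: W_s_zero_def)
qed

lemma W_s_zero_diff:
  fixes u v :: "real ^ 'n \<Rightarrow> real"
  assumes s: "0 < s" "s < 1" and U: "bounded U" "open U" "lipschitz_boundary U"
    and v: "v \<in> W_s_ext s \<phi> U" and u: "u \<in> W_s_ext s \<phi> U"
  shows "(\<lambda>x. v x - u x) \<in> W_s_zero s U"
proof (rule W_s_zero_of_W_s[OF s U])
  show "(\<lambda>x. v x - u x) \<in> W_s s U"
    using W_s_add_mult[of v s U u "- 1"] u v U(2) by (simp add: W_s_ext_def)
  have "AE x in lebesgue. x \<notin> U \<longrightarrow> v x = \<phi> x" "AE x in lebesgue. x \<notin> U \<longrightarrow> u x = \<phi> x"
    using u v by (auto simp: W_s_ext_def)
  then show "AE x in lebesgue. x \<notin> U \<longrightarrow> v x - u x = 0"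
    by eventually_elim simp
qed

lemma Cc_infinity_subset_W_s_zero:
  fixes w :: "real ^ 'n \<Rightarrow> real"
  assumes s: "0 < s" "s < 1" and w: "w \<in> Cc_infinity U"
  shows "w \<in> W_s_zero s U"
proof -
  obtain K where K: "compact K" "K \<subseteq> U" "\<And>x. x \<notin> K \<Longrightarrow> w x = 0"
    using Cc_infinity_support[OF w] by blast
  have "continuous_on UNIV w"
    using w by (rule Cc_infinity_continuous)
  then have meas: "w \<in> borel_measurable borel"
    by (rule borel_measurable_continuous_onI)
  have "integrable lborel (\<lambda>x. indicator K x *\<^sub>R w x)"
    using K(1) continuous_on_subset[OF \<open>continuous_on UNIV w\<close>]
    by (intro borel_integrable_compact) auto
  also have "(\<lambda>x. indicator K x *\<^sub>R w x) = w"
    using K(3) by (auto simp: indicator_def fun_eq_iff)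
  finally have "integrable lebesgue w"
    using meas by (simp add: integrable_completion)
  moreover have "AE x in lebesgue. x \<notin> U \<longrightarrow> w x = 0"
    using K(2,3) by (intro always_eventually) blast
  ultimately show ?thesis
    using meas integrable_gagliardo_Cc_infinity[OF w s] by (simp add: W_s_zero_def measurable_completion)
qed

lemma W_s_zero_mult:
  assumes "w \<in> W_s_zero s U"
  shows "(\<lambda>x. c * w x) \<in> W_s_zero s U"
proof -
  have "gagliardo s (\<lambda>x. c * w x) = (\<lambda>z. \<bar>c\<bar> * gagliardo s w z)"
    by (simp add: gagliardo_def fun_eq_iff right_diff_distrib[symmetric] abs_mult)
  then show ?thesis
    using assms by (auto simp: W_s_zero_def elim!: eventually_mono)
qed

text \<open>Truncation is a contraction, so it does not increase the energy.\<close>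

lemma W_s_zero_truncate:
  fixes w :: "real ^ 'n \<Rightarrow> real"
  assumes w: "w \<in> W_s_zero s U" and M: "0 \<le> M"
  shows "(\<lambda>x. max (- M) (min M (w x))) \<in> W_s_zero s U"
    and "gagliardo s (\<lambda>x. max (- M) (min M (w x))) z \<le> gagliardo s w z"
proof -
  let ?w = "\<lambda>x. max (- M) (min M (w x))"
  have le: "gagliardo s ?w z \<le> gagliardo s w z" for z
    unfolding gagliardo_def case_prod_beta by (intro divide_right_mono) auto
  then show "gagliardo s ?w z \<le> gagliardo s w z" .
  have meas: "?w \<in> borel_measurable lebesgue"
    using w by (auto simp: W_s_zero_def)
  have "integrable lebesgue ?w"
    by (rule Bochner_Integration.integrable_bound[of lebesgue w])
       (use w M meas in \<open>auto simp: W_s_zero_def\<close>)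
  moreover have "integrable lebesgue (gagliardo s ?w)"
    by (rule Bochner_Integration.integrable_bound[of lebesgue "gagliardo s w"])
       (use w le meas in \<open>auto simp: W_s_zero_def gagliardo_nonneg intro: borel_measurable_lebesgue_gagliardo\<close>)
  ultimately show "?w \<in> W_s_zero s U"
    using w M meas by (auto simp: W_s_zero_def elim!: eventually_mono)
qed

section \<open>The obstacle problem\<close>

lemma W_s_obst_add:
  fixes u w :: "real ^ 'n \<Rightarrow> real"
  assumes u: "u \<in> W_s_obst s \<phi> \<psi> \<Omega> A" and w: "w \<in> W_s_zero s \<Omega>" and \<Omega>: "open \<Omega>"
    and above: "AE x in lebesgue. x \<in> A \<longrightarrow> \<psi> x \<le> u x + t * w x"
  shows "(\<lambda>x. u x + t * w x) \<in> W_s_obst s \<phi> \<psi> \<Omega> A"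
proof -
  have "(\<lambda>x. u x + t * w x) \<in> W_s s \<Omega>"
    using u by (intro W_s_add_mult W_s_zero_subset_W_s[OF w \<Omega>] \<Omega>) (simp add: W_s_obst_def W_s_ext_def)
  moreover have "AE x in lebesgue. x \<notin> \<Omega> \<longrightarrow> u x = \<phi> x" "AE x in lebesgue. x \<notin> \<Omega> \<longrightarrow> w x = 0"
    using u w by (auto simp: W_s_obst_def W_s_ext_def W_s_zero_def)
  then have "AE x in lebesgue. x \<notin> \<Omega> \<longrightarrow> u x + t * w x = \<phi> x"
    by eventually_elim simp
  ultimately show ?thesis
    using above by (simp add: W_s_obst_def W_s_ext_def)
qed

text \<open>The admissible class is convex, so with \<open>u\<close> and \<open>u + w\<close> it contains the segment between them.\<close>

lemma pairing_nonneg_of_solves: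
  fixes u w :: "real ^ 'n \<Rightarrow> real"
  assumes s: "0 < s" and \<Omega>: "open \<Omega>" and solves: "solves_obstacle_problem s \<phi> \<psi> \<Omega> A u"
    and w: "w \<in> W_s_zero s \<Omega>" and above: "AE x in lebesgue. x \<in> A \<longrightarrow> \<psi> x \<le> u x + w x"
  shows "0 \<le> H_s_pairing s u w"
proof (rule pairing_nonneg_of_minimizes_F_s)
  have u: "u \<in> W_s_obst s \<phi> \<psi> \<Omega> A"
    using solves by (simp add: solves_obstacle_problem_def minimizes_F_s_def)
  then show "u \<in> borel_measurable lebesgue"
    by (simp add: W_s_obst_def W_s_ext_def W_s_def)
  show "minimizes_F_s s \<Omega> (W_s_obst s \<phi> \<psi> \<Omega> A) u"
    using solves by (simp add: solves_obstacle_problem_def)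
  fix t :: real assume t: "0 < t" "t \<le> 1"
  have "AE x in lebesgue. x \<in> A \<longrightarrow> \<psi> x \<le> u x"
    using u by (simp add: W_s_obst_def)
  with above have "AE x in lebesgue. x \<in> A \<longrightarrow> \<psi> x \<le> u x + t * w x"
  proof eventually_elim
    case (elim x)
    show ?case
    proof
      assume "x \<in> A"
      then have "\<psi> x \<le> u x + w x" "\<psi> x \<le> u x"
        using elim by auto
      then have "(1 - t) * \<psi> x + t * \<psi> x \<le> (1 - t) * u x + t * (u x + w x)"
        using t by (intro add_mono mult_left_mono) auto
      then show "\<psi> x \<le> u x + t * w x"
        by (simp add: algebra_simps)
    qed
  qed
  then show "(\<lambda>x. u x + t * w x) \<in> W_s_obst s \<phi> \<psi> \<Omega> A"
    by (rule W_s_obst_add[OF u w \<Omega>])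
qed (use assms in \<open>auto simp: W_s_zero_def\<close>)

lemma H_s_pairing_mult: "H_s_pairing s u (\<lambda>x. c * w x) = c * H_s_pairing s u w"
proof -
  have "H_s_integrand s u (\<lambda>x. c * w x) = (\<lambda>z. c * H_s_integrand s u w z)"
    by (simp add: H_s_integrand_def fun_eq_iff right_diff_distrib[symmetric])
  then show ?thesis
    by (simp add: H_s_pairing_def)
qed

text \<open>A bounded variation, scaled so that its absolute value is at most \<open>\<delta>\<close>, may be added to \<open>u\<close> with either sign
  without crossing the obstacle.\<close>

lemma pairing_eq_0_of_bounded:
  fixes u w :: "real ^ 'n \<Rightarrow> real"
  assumes s: "0 < s" and \<Omega>: "open \<Omega>" and solves: "solves_obstacle_problem s \<phi> \<psi> \<Omega> A u"
    and U: "U \<subseteq> \<Omega>" and \<delta>: "0 < \<delta>" and gap: "AE x in lebesgue. x \<in> U \<inter> A \<longrightarrow> \<psi> x + \<delta> \<le> u x"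
    and w: "w \<in> W_s_zero s U" and B: "\<And>x. \<bar>w x\<bar> \<le> B"
  shows "H_s_pairing s u w = 0"
proof -
  have "0 \<le> B"
    using B[of 0] by linarith
  \<comment> \<open>Dividing by \<open>B + 1\<close> covers the case \<open>B = 0\<close>.\<close>
  define c where "c = \<delta> / (B + 1)"
  have c: "0 < c"
    using \<delta> \<open>0 \<le> B\<close> by (simp add: c_def)
  have u: "AE x in lebesgue. x \<in> A \<longrightarrow> \<psi> x \<le> u x"
    using solves by (simp add: solves_obstacle_problem_def minimizes_F_s_def W_s_obst_def)
  have zero: "AE x in lebesgue. x \<notin> U \<longrightarrow> w x = 0"
    using w by (simp add: W_s_zero_def)
  have sign: "0 \<le> d * H_s_pairing s u w" if d: "\<bar>d\<bar> = c" for d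
    unfolding H_s_pairing_mult[symmetric]
  proof (rule pairing_nonneg_of_solves[OF s \<Omega> solves])
    show "(\<lambda>x. d * w x) \<in> W_s_zero s \<Omega>"
      by (rule W_s_zero_mult) (rule W_s_zero_mono[OF w U])
    have small: "\<bar>d * w x\<bar> \<le> \<delta>" for x
    proof -
      have "\<bar>d * w x\<bar> \<le> c * (B + 1)"
        unfolding abs_mult d using B[of x] c by (intro mult_left_mono) auto
      then show ?thesis
        using \<open>0 \<le> B\<close> by (simp add: c_def)
    qed
    show "AE x in lebesgue. x \<in> A \<longrightarrow> \<psi> x \<le> u x + d * w x"
      using u zero gap
    proof eventually_elim
      case (elim x)
      then show ?case
        using small[of x] by (cases "x \<in> U") auto
    qed
  qed
  show ?thesis
    using sign[of c] sign[of "- c"] c by (simp add: zero_le_mult_iff mult_le_0_iff)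
qed

text \<open>An unbounded variation is the limit of its truncations, which have pairing zero; their integrands are
  dominated by the Gagliardo integrand of \<open>w\<close>.\<close>

lemma pairing_eq_0:
  fixes u w :: "real ^ 'n \<Rightarrow> real"
  assumes s: "0 < s" and \<Omega>: "open \<Omega>" and solves: "solves_obstacle_problem s \<phi> \<psi> \<Omega> A u"
    and U: "U \<subseteq> \<Omega>" and \<delta>: "0 < \<delta>" and gap: "AE x in lebesgue. x \<in> U \<inter> A \<longrightarrow> \<psi> x + \<delta> \<le> u x"
    and w: "w \<in> W_s_zero s U"
  shows "H_s_pairing s u w = 0"
proof -
  define v where "v m x = max (- real m) (min (real m) (w x))" for m x
  have v: "v m \<in> W_s_zero s U" "gagliardo s (v m) z \<le> gagliardo s w z" for m z
    unfolding v_def[abs_def] by (rule W_s_zero_truncate[OF w]; simp)+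
  have u: "u \<in> borel_measurable lebesgue"
    using solves by (simp add: solves_obstacle_problem_def minimizes_F_s_def W_s_obst_def W_s_ext_def W_s_def)
  have "(\<lambda>m. H_s_pairing s u (v m)) \<longlonglongrightarrow> H_s_pairing s u w"
    unfolding H_s_pairing_def
  proof (rule integral_dominated_convergence[where w = "\<lambda>z. 2 * gagliardo s w z"])
    show "H_s_integrand s u w \<in> borel_measurable lebesgue" "H_s_integrand s u (v m) \<in> borel_measurable lebesgue" for m
      using w v(1)[of m] u by (auto simp: W_s_zero_def intro!: H_s_integrand_measurable)
    show "integrable lebesgue (\<lambda>z. 2 * gagliardo s w z)"
      using w by (simp add: W_s_zero_def)
    show "AE z in lebesgue. norm (H_s_integrand s u (v m) z) \<le> 2 * gagliardo s w z" for m
    proof (intro always_eventually allI)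
      fix z
      show "norm (H_s_integrand s u (v m) z) \<le> 2 * gagliardo s w z"
        using abs_H_s_integrand_le[of s u "v m" z] s v(2)[of m z] by simp
    qed
    show "AE z in lebesgue. (\<lambda>m. H_s_integrand s u (v m) z) \<longlonglongrightarrow> H_s_integrand s u w z"
    proof (intro always_eventually allI)
      fix z :: "(real ^ 'n) \<times> (real ^ 'n)"
      obtain m0 where m0: "\<bar>w (fst z)\<bar> + \<bar>w (snd z)\<bar> \<le> real m0"
        using real_arch_simple by blast
      have "eventually (\<lambda>m. H_s_integrand s u (v m) z = H_s_integrand s u w z) sequentially"
        using eventually_ge_at_top[of m0]
      proof eventually_elim
        case (elim m)
        then have "real m0 \<le> real m" by simp
        then have "v m (fst z) = w (fst z)" "v m (snd z) = w (snd z)"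
          using m0 unfolding v_def by linarith+
        then show ?case
          by (simp add: H_s_integrand_def case_prod_beta)
      qed
      then show "(\<lambda>m. H_s_integrand s u (v m) z) \<longlonglongrightarrow> H_s_integrand s u w z"
        by (rule tendsto_eventually)
    qed
  qed
  moreover have "H_s_pairing s u (v m) = 0" for m
    using v(1) by (rule pairing_eq_0_of_bounded[OF s \<Omega> solves U \<delta> gap, where B = "real m"])
      (simp add: v_def abs_le_iff)
  ultimately show ?thesis
    by (simp add: LIMSEQ_const_iff)
qed

lemma AE_of_essinf_on_ge:
  fixes f :: "'a::euclidean_space \<Rightarrow> real"
  assumes "S \<in> sets lebesgue" "ereal \<delta> \<le> essinf_on S f"
  shows "AE x in lebesgue. x \<in> S \<longrightarrow> \<delta> \<le> f x"
proof -
  have "esssup (lebesgue_on S) (\<lambda>x. - ereal (f x)) \<le> - ereal \<delta>"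
    using assms(2) ereal_minus_le_minus[of "- esssup (lebesgue_on S) (\<lambda>x. - ereal (f x))" "ereal \<delta>"]
    unfolding essinf_on_def by simp
  with esssup_AE[of "\<lambda>x. - ereal (f x)" "lebesgue_on S"]
  have "AE x in lebesgue_on S. \<delta> \<le> f x"
  proof (elim eventually_mono)
    fix x
    assume "- ereal (f x) \<le> esssup (lebesgue_on S) (\<lambda>x. - ereal (f x))"
      "esssup (lebesgue_on S) (\<lambda>x. - ereal (f x)) \<le> - ereal \<delta>"
    then have "- ereal (f x) \<le> - ereal \<delta>"
      by (rule order_trans)
    then show "\<delta> \<le> f x"
      by simp
  qed
  then show ?thesis
    using assms(1) by (simp add: AE_restrict_space_iff)
qed

theorem proposition2p6:
  fixes s :: real
    and \<Omega> A :: "(real ^ 'n) set"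
    and \<phi> \<psi> u :: "real ^ 'n \<Rightarrow> real"
  assumes s: "0 < s" "s < 1"
    and \<Omega>: "bounded \<Omega>" "open \<Omega>" "lipschitz_boundary \<Omega>"
    and \<phi>: "\<phi> \<in> borel_measurable lebesgue"
    and A: "open A" "A \<subseteq> \<Omega>"
    and \<psi>: "\<psi> \<in> L_infinity_on A"
    and u: "u \<in> W_s_obst s \<phi> \<psi> \<Omega> A"
  shows
    \<comment> \<open>The pairings below are absolutely convergent integrals.\<close>
    "(\<forall>v \<in> W_s_obst s \<phi> \<psi> \<Omega> A. H_s_pairing_converges s u (\<lambda>x. v x - u x)) \<and>
     (\<forall>w \<in> Cc_infinity \<Omega>. H_s_pairing_converges s u w) \<and>
     (solves_obstacle_problem s \<phi> \<psi> \<Omega> A u \<longleftrightarrow>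
       (\<forall>v \<in> W_s_obst s \<phi> \<psi> \<Omega> A. H_s_pairing s u (\<lambda>x. v x - u x) \<ge> 0)) \<and>
     (solves_obstacle_problem s \<phi> \<psi> \<Omega> A u \<longrightarrow>
       (\<forall>w \<in> Cc_infinity \<Omega>. (\<forall>x. w x \<ge> 0) \<longrightarrow> H_s_pairing s u w \<ge> 0) \<and>
       (\<forall>U \<delta>. open U \<and> U \<subseteq> \<Omega> \<and> \<delta> > 0 \<and> essinf_on (U \<inter> A) (\<lambda>x. u x - \<psi> x) \<ge> ereal \<delta> \<longrightarrow>
          (\<forall>w \<in> Cc_infinity U. H_s_pairing s u w = 0) \<and>
          (lipschitz_boundary U \<longrightarrow> minimizes_F_s s U (W_s_ext s u U) u)))"
proof -
  let ?K = "W_s_obst s \<phi> \<psi> \<Omega> A"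
  have s0: "0 \<le> s" using s by simp
  have u_meas: "u \<in> borel_measurable lebesgue"
    using u by (simp add: W_s_obst_def W_s_ext_def W_s_def)
  have converges: "H_s_pairing_converges s u w" if "w \<in> W_s_zero s U" for w U
    using that by (intro H_s_pairing_converges_of_finite_energy s0 u_meas) (simp_all add: W_s_zero_def)
  have diff: "(\<lambda>x. v x - u x) \<in> W_s_zero s \<Omega>" if "v \<in> ?K" for v
    using that u by (intro W_s_zero_diff[OF s \<Omega>, where \<phi> = \<phi>]) (simp_all add: W_s_obst_def)
  have iff: "solves_obstacle_problem s \<phi> \<psi> \<Omega> A u \<longleftrightarrow> (\<forall>v \<in> ?K. H_s_pairing s u (\<lambda>x. v x - u x) \<ge> 0)"
  proof (intro iffI ballI)
    fix v assume solves: "solves_obstacle_problem s \<phi> \<psi> \<Omega> A u" and v: "v \<in> ?K"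
    have "AE x in lebesgue. x \<in> A \<longrightarrow> \<psi> x \<le> v x"
      using v by (simp add: W_s_obst_def)
    then have "AE x in lebesgue. x \<in> A \<longrightarrow> \<psi> x \<le> u x + (v x - u x)"
      by simp
    then show "0 \<le> H_s_pairing s u (\<lambda>x. v x - u x)"
      by (rule pairing_nonneg_of_solves[OF s(1) \<Omega>(2) solves diff[OF v]])
  next
    assume nonneg: "\<forall>v \<in> ?K. H_s_pairing s u (\<lambda>x. v x - u x) \<ge> 0"
    show "solves_obstacle_problem s \<phi> \<psi> \<Omega> A u"
      unfolding solves_obstacle_problem_def
    proof (rule minimizes_F_s_of_pairing_nonneg[OF s0 \<Omega>(2) u])
      fix v assume v: "v \<in> ?K"
      show "v \<in> borel_measurable lebesgue"
        using v by (simp add: W_s_obst_def W_s_ext_def W_s_def)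
      show "integrable lebesgue (gagliardo s (\<lambda>x. v x - u x))"
        "AE x in lebesgue. x \<notin> \<Omega> \<longrightarrow> v x - u x = 0"
        using diff[OF v] by (simp_all add: W_s_zero_def)
      show "0 \<le> H_s_pairing s u (\<lambda>x. v x - u x)"
        using nonneg v by blast
    qed
  qed
  have supersolution: "H_s_pairing s u w \<ge> 0"
    if "solves_obstacle_problem s \<phi> \<psi> \<Omega> A u" "w \<in> Cc_infinity \<Omega>" "\<forall>x. w x \<ge> 0" for w
  proof (rule pairing_nonneg_of_solves[OF s(1) \<Omega>(2) that(1)])
    show "w \<in> W_s_zero s \<Omega>"
      by (rule Cc_infinity_subset_W_s_zero[OF s that(2)])
    have "AE x in lebesgue. x \<in> A \<longrightarrow> \<psi> x \<le> u x"
      using u by (simp add: W_s_obst_def)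
    then show "AE x in lebesgue. x \<in> A \<longrightarrow> \<psi> x \<le> u x + w x"
      using that(3) by (auto elim!: eventually_mono intro: add_increasing2)
  qed
  have off_contact: "(\<forall>w \<in> Cc_infinity U. H_s_pairing s u w = 0) \<and>
      (lipschitz_boundary U \<longrightarrow> minimizes_F_s s U (W_s_ext s u U) u)"
    if solves: "solves_obstacle_problem s \<phi> \<psi> \<Omega> A u"
      and U: "open U" "U \<subseteq> \<Omega>" and \<delta>: "\<delta> > 0" "essinf_on (U \<inter> A) (\<lambda>x. u x - \<psi> x) \<ge> ereal \<delta>" for U \<delta>
  proof -
    have "AE x in lebesgue. x \<in> U \<inter> A \<longrightarrow> \<delta> \<le> u x - \<psi> x"
      using U(1) A(1) by (intro AE_of_essinf_on_ge \<delta>(2) open_sets_lebesgue) auto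
    then have gap: "AE x in lebesgue. x \<in> U \<inter> A \<longrightarrow> \<psi> x + \<delta> \<le> u x"
      by (auto elim!: eventually_mono)
    note zero = pairing_eq_0[OF s(1) \<Omega>(2) solves U(2) \<delta>(1) gap]
    have "H_s_pairing s u w = 0" if "w \<in> Cc_infinity U" for w
      using Cc_infinity_subset_W_s_zero[OF s that] by (rule zero)
    moreover have "minimizes_F_s s U (W_s_ext s u U) u" if lip: "lipschitz_boundary U"
    proof (rule minimizes_F_s_of_pairing_nonneg[OF s0 U(1)])
      have U_bounded: "bounded U"
        using \<Omega>(1) U(2) by (rule bounded_subset)
      have "u \<in> W_s s \<Omega>"
        using u by (simp add: W_s_obst_def W_s_ext_def)
      then show uU: "u \<in> W_s_ext s u U"
        using W_s_subset U by (simp add: W_s_ext_def)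
      fix v assume v: "v \<in> W_s_ext s u U"
      then show "v \<in> borel_measurable lebesgue"
        by (simp add: W_s_ext_def W_s_def)
      have w: "(\<lambda>x. v x - u x) \<in> W_s_zero s U"
        by (rule W_s_zero_diff[OF s U_bounded U(1) lip v uU])
      then show "integrable lebesgue (gagliardo s (\<lambda>x. v x - u x))"
        "AE x in lebesgue. x \<notin> U \<longrightarrow> v x - u x = 0"
        by (simp_all add: W_s_zero_def)
      show "0 \<le> H_s_pairing s u (\<lambda>x. v x - u x)"
        using zero[OF w] by simp
    qed
    ultimately show ?thesis by blast
  qed
  show ?thesis
  proof (intro conjI impI)
    show "\<forall>v \<in> ?K. H_s_pairing_converges s u (\<lambda>x. v x - u x)"
      using converges[OF diff] by blast
    show "\<forall>w \<in> Cc_infinity \<Omega>. H_s_pairing_converges s u w"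
      using converges[OF Cc_infinity_subset_W_s_zero[OF s]] by blast
    show "solves_obstacle_problem s \<phi> \<psi> \<Omega> A u \<longleftrightarrow> (\<forall>v \<in> ?K. H_s_pairing s u (\<lambda>x. v x - u x) \<ge> 0)"
      by (rule iff)
    assume solves: "solves_obstacle_problem s \<phi> \<psi> \<Omega> A u"
    show "\<forall>w \<in> Cc_infinity \<Omega>. (\<forall>x. w x \<ge> 0) \<longrightarrow> H_s_pairing s u w \<ge> 0"
      using supersolution[OF solves] by blast
    show "\<forall>U \<delta>. open U \<and> U \<subseteq> \<Omega> \<and> \<delta> > 0 \<and> essinf_on (U \<inter> A) (\<lambda>x. u x - \<psi> x) \<ge> ereal \<delta> \<longrightarrow>
        (\<forall>w \<in> Cc_infinity U. H_s_pairing s u w = 0) \<and>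
        (lipschitz_boundary U \<longrightarrow> minimizes_F_s s U (W_s_ext s u U) u)"
    proof (intro allI impI)
      fix U \<delta>
      assume "open U \<and> U \<subseteq> \<Omega> \<and> \<delta> > 0 \<and> essinf_on (U \<inter> A) (\<lambda>x. u x - \<psi> x) \<ge> ereal \<delta>"
      then show "(\<forall>w \<in> Cc_infinity U. H_s_pairing s u w = 0) \<and>
          (lipschitz_boundary U \<longrightarrow> minimizes_F_s s U (W_s_ext s u U) u)"
        by (elim conjE) (rule off_contact[OF solves])
    qed
  qed
qed

end
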